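(* Let $\mathcal{A}$ be a complex Banach algebra with unity, $a,b,c\in\mathcal{A}$, $k$ a positive integer, and $M=\begin{pmatrix}a&b\\ c&0\end{pmatrix}\in M_{2}(\mathcal{A})$. Suppose $a(bc)\alpha_{1}\cdots\alpha_{k}=0$ for all $\alpha_{1},\dots,\alpha_{k}\in\{a,bc\}$. Then $a$ and $bc$ are both g$\pi$-Hirano invertible in $\mathcal{A}$ if and only if $M$ is g$\pi$-Hirano invertible in $M_{2}(\mathcal{A})$.
   Context: $M_{2}(\mathcal{A})$ is the Banach algebra of $2\times2$ matrices over $\mathcal{A}$. For a unital Banach algebra $\mathcal{B}$, $\mathcal{B}^{qnil}$ is the set of elements with spectrum $\{0\}$, and $a\in\mathcal{B}$ is g$\pi$-Hirano invertible if there exists $x\in\mathcal{B}$ with $xax=x$, $ax=xa$ and $a-a^{n+2}x\in\mathcal{B}^{qnil}$ for some positive integer $n$. *)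

theory Defs
  imports "HOL-Analysis.Analysis"
begin

text \<open>A complex unital Banach algebra: a real unital Banach algebra together with a
  compatible complex scalar multiplication.\<close>
class complex_banach_algebra_1 = real_normed_algebra_1 + banach +
  fixes scaleC :: "complex \<Rightarrow> 'a \<Rightarrow> 'a"
  assumes scaleC_add_right: "scaleC c (x + y) = scaleC c x + scaleC c y"
    and scaleC_add_left: "scaleC (c + d) x = scaleC c x + scaleC d x"
    and scaleC_scaleC: "scaleC c (scaleC d x) = scaleC (c * d) x"
    and scaleC_one: "scaleC 1 x = x"
    and scaleC_of_real: "scaleC (of_real r) x = scaleR r x"
    and mult_scaleC_left: "scaleC c x * y = scaleC c (x * y)"
    and mult_scaleC_right: "x * scaleC c y = scaleC c (x * y)"
    and norm_scaleC: "norm (scaleC c x) = cmod c * norm x"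

section \<open>Notions in the algebra A\<close>

definition inv_el :: "'a::ring_1 \<Rightarrow> bool" where
  "inv_el a \<longleftrightarrow> (\<exists>y. a * y = 1 \<and> y * a = 1)"

definition spec :: "'a::complex_banach_algebra_1 \<Rightarrow> complex set" where
  "spec a = {z. \<not> inv_el (a - scaleC z 1)}"

definition qnil :: "'a::complex_banach_algebra_1 \<Rightarrow> bool" where
  "qnil a \<longleftrightarrow> spec a = {0}"

definition gpi_Hirano :: "'a::complex_banach_algebra_1 \<Rightarrow> bool" where
  "gpi_Hirano a \<longleftrightarrow> (\<exists>x. x * a * x = x \<and> a * x = x * a \<and>
      (\<exists>n::nat. n > 0 \<and> qnil (a - a ^ (n + 2) * x)))"

section \<open>Notions in M_2(A), 2x2 matrices with the matrix product\<close>

definition mpow :: "'a::semiring_1^'n^'n \<Rightarrow> nat \<Rightarrow> 'a^'n^'n" where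
  "mpow M n = (((**) M) ^^ n) (mat 1)"

definition spec_M2 :: "'a::complex_banach_algebra_1^2^2 \<Rightarrow> complex set" where
  "spec_M2 M = {z. \<not> invertible (M - mat (scaleC z 1))}"

definition qnil_M2 :: "'a::complex_banach_algebra_1^2^2 \<Rightarrow> bool" where
  "qnil_M2 M \<longleftrightarrow> spec_M2 M = {0}"

definition gpi_Hirano_M2 :: "'a::complex_banach_algebra_1^2^2 \<Rightarrow> bool" where
  "gpi_Hirano_M2 M \<longleftrightarrow> (\<exists>X. X ** M ** X = X \<and> M ** X = X ** M \<and>
      (\<exists>n::nat. n > 0 \<and> qnil_M2 (M - mpow M (n + 2) ** X)))"

definition mat2 :: "'a::zero \<Rightarrow> 'a \<Rightarrow> 'a \<Rightarrow> 'a \<Rightarrow> 'a^2^2" where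
  "mat2 p q r s = (\<chi> i j. if i = 1 then (if j = 1 then p else q) else (if j = 1 then r else s))"

end

theory Submission
  imports Defs "HOL-Computational_Algebra.Fundamental_Theorem_Algebra"
    "HOL-Computational_Algebra.Formal_Power_Series"
begin

text \<open>
  An element is g\<open>\<pi>\<close>-Hirano invertible iff, for some \<open>n > 0\<close>, its spectrum lies in
  \<open>{0} \<union> {z. z ^ n = 1}\<close>. If \<open>x\<close> is an inverse, split along the idempotent \<open>a x\<close>. Conversely,
  \<open>a - a ^ (n + 1)\<close> then has spectrum in \<open>{0}\<close>, Rickart's averaging argument turns this into
  super-exponential decay of the norms of its powers, and the binomial series lifts \<open>a ^ n\<close>, which
  is idempotent up to a quasinilpotent, to an idempotent.

  It remains to compare spectra away from \<open>0\<close>. Put \<open>d = b c\<close>. By a Schur complement, \<open>M - z\<close> is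
  invertible iff \<open>T = z a + d - z\<^sup>2\<close> is. Writing \<open>y = z a + d\<close>, the hypothesis gives \<open>a d y ^ k = 0\<close>,
  so \<open>a d = \<nu> T\<close> for the nilpotent \<open>\<nu> = - z\<^sup>-\<^sup>2 a d (\<Sum>j<k. (y / z\<^sup>2) ^ j)\<close> and
  \<open>(a - z) (d - z\<^sup>2) = a d - z T = (\<nu> - z) T\<close>. Thus \<open>M - z\<close> is invertible iff \<open>(a - z) (d - z\<^sup>2)\<close>
  is. When this product is invertible on a connected set on which \<open>a - z\<close> is invertible somewhere,
  both factors are invertible throughout.
\<close>

section \<open>Complex scalars and invertible elements\<close>

lemma scaleC_zero_left [simp]: "scaleC 0 (x::'a::complex_banach_algebra_1) = 0"
  using scaleC_of_real[of 0 x] by simp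

lemma scaleC_zero_right [simp]: "scaleC z (0::'a::complex_banach_algebra_1) = 0"
  using scaleC_add_right[of z "0::'a" 0] by simp

lemma scaleC_minus_left: "scaleC (- z) (x::'a::complex_banach_algebra_1) = - scaleC z x"
  using scaleC_add_left[of "- z" z x] by (simp add: eq_neg_iff_add_eq_0)

lemma scaleC_minus_right: "scaleC z (- (x::'a::complex_banach_algebra_1)) = - scaleC z x"
  using scaleC_add_right[of z "- x" x] by (simp add: eq_neg_iff_add_eq_0)

lemma scaleC_diff_right:
  "scaleC z (x - y) = scaleC z (x::'a::complex_banach_algebra_1) - scaleC z y"
  using scaleC_add_right[of z x "- y"] by (simp add: scaleC_minus_right)

lemma scaleC_diff_left:
  "scaleC (z - w) (x::'a::complex_banach_algebra_1) = scaleC z x - scaleC w x"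
  using scaleC_add_left[of z "- w" x] by (simp add: scaleC_minus_left)

lemma scaleC_sum_left:
  "scaleC (\<Sum>i\<in>I. g i) (x::'a::complex_banach_algebra_1) = (\<Sum>i\<in>I. scaleC (g i) x)"
  by (induction I rule: infinite_finite_induct) (auto simp: scaleC_add_left)

lemma scaleC_power:
  "(scaleC z (x::'a::complex_banach_algebra_1)) ^ n = scaleC (z ^ n) (x ^ n)"
  by (induction n)
    (auto simp: scaleC_one mult_scaleC_left mult_scaleC_right scaleC_scaleC mult.commute)

lemmas scaleC_simps = scaleC_add_right scaleC_add_left scaleC_diff_right scaleC_diff_left
  scaleC_scaleC scaleC_one mult_scaleC_left mult_scaleC_right scaleC_minus_left scaleC_minus_right

lemma bounded_linear_scaleC_left:
  "bounded_linear (\<lambda>z. scaleC z (x::'a::complex_banach_algebra_1))"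
proof (rule bounded_linear_intro[where K = "norm x"])
  show "scaleC (r *\<^sub>R z) x = r *\<^sub>R scaleC z x" for r z
    unfolding scaleR_conv_of_real[of r z] scaleC_scaleC[symmetric] scaleC_of_real ..
qed (auto simp: scaleC_simps norm_scaleC)

lemma continuous_on_scaleC [continuous_intros]:
  "continuous_on S f \<Longrightarrow> continuous_on S (\<lambda>z. scaleC (f z) (x::'a::complex_banach_algebra_1))"
  by (rule bounded_linear.continuous_on[OF bounded_linear_scaleC_left])

lemma inv_elI: "x * y = 1 \<Longrightarrow> w * x = 1 \<Longrightarrow> inv_el (x::'a::ring_1)"
  unfolding inv_el_def by (metis mult.assoc mult_1_left mult_1_right)

lemma inv_el_mult: "inv_el x \<Longrightarrow> inv_el y \<Longrightarrow> inv_el (x * y :: 'a::ring_1)"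
  unfolding inv_el_def by (metis mult.assoc mult_1_left)

lemma inv_el_mult_left_cancel:
  assumes "inv_el (x::'a::ring_1)"
  shows "inv_el (x * y) \<longleftrightarrow> inv_el y"
proof
  assume xy: "inv_el (x * y)"
  obtain x' where x': "x * x' = 1" "x' * x = 1" using assms by (auto simp: inv_el_def)
  then have "inv_el x'" by (auto simp: inv_el_def)
  then have "inv_el (x' * (x * y))" using xy by (rule inv_el_mult)
  then show "inv_el y" by (simp add: x' flip: mult.assoc)
qed (rule inv_el_mult[OF assms])

lemma inv_el_scaleC_one:
  "z \<noteq> 0 \<Longrightarrow> inv_el (scaleC z (1::'a::complex_banach_algebra_1))"
  by (rule inv_elI[where y = "scaleC (inverse z) 1" and w = "scaleC (inverse z) 1"])
    (auto simp: scaleC_simps)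

lemma inv_el_scaleC:
  assumes "z \<noteq> 0"
  shows "inv_el (scaleC z x) \<longleftrightarrow> inv_el (x::'a::complex_banach_algebra_1)"
  using inv_el_mult_left_cancel[OF inv_el_scaleC_one[OF assms], of x]
  by (simp add: scaleC_simps)

section \<open>Polynomials in an element\<close>

text \<open>Horner's scheme: the coefficients are complex scalars while the argument lies in the
  algebra.\<close>

definition peval :: "complex poly \<Rightarrow> 'a::complex_banach_algebra_1 \<Rightarrow> 'a" where
  "peval p a = fold_coeffs (\<lambda>z x. scaleC z 1 + a * x) p 0"

lemma peval_0 [simp]: "peval 0 a = 0"
  by (simp add: peval_def)

lemma peval_pCons [simp]: "peval (pCons z p) a = scaleC z 1 + a * peval p a"
  by (cases "p = 0 \<and> z = 0") (auto simp: peval_def)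

lemma peval_add [simp]: "peval (p + q) a = peval p a + peval q a"
  by (induction p q rule: poly_induct2) (auto simp: scaleC_simps algebra_simps)

lemma peval_smult [simp]: "peval (smult z p) a = scaleC z (peval p a)"
  by (induction p) (auto simp: scaleC_simps)

lemma peval_diff [simp]: "peval (p - q) a = peval p a - peval q a"
  using peval_add[of "p - q" q a] by (simp add: algebra_simps)

lemma peval_monom [simp]: "peval (monom 1 n) a = a ^ n"
  by (induction n) (auto simp: monom_0 monom_Suc scaleC_simps)

lemma peval_linear_mult: "peval ([:- z, 1:] * q) a = (a - scaleC z 1) * peval q a"
  by (simp add: scaleC_simps algebra_simps)

lemma peval_commute: "peval p a * a = a * peval p a"
  by (induction p) (auto simp: scaleC_simps algebra_simps)

text \<open>One half of the spectral mapping theorem: over the complex numbers \<open>p\<close>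
  splits into linear factors, so \<open>peval p a\<close> is a nonzero scalar times a product of
  elements \<open>a - scaleC z 1\<close> with \<open>z\<close> a root of \<open>p\<close>.\<close>

lemma inv_el_peval:
  assumes "p \<noteq> 0" "\<And>z. poly p z = 0 \<Longrightarrow> inv_el (a - scaleC z 1)"
  shows "inv_el (peval p a)"
  using assms
proof (induction "degree p" arbitrary: p)
  case 0
  then obtain z where "p = [:z:]" by (metis degree_eq_zeroE)
  with 0 show ?case by (simp add: inv_el_scaleC_one)
next
  case (Suc m)
  then have "\<not> constant (poly p)" by (simp add: constant_degree)
  then obtain z where z: "poly p z = 0" using fundamental_theorem_of_algebra by blast
  then obtain q where q: "p = [:- z, 1:] * q" by (metis dvdE poly_eq_0_iff_dvd)
  with Suc.prems(1) have "q \<noteq> 0" by auto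
  then have "degree p = Suc (degree q)" unfolding q by (subst degree_mult_eq) auto
  with Suc have "inv_el (peval q a)" using \<open>q \<noteq> 0\<close> q by auto
  then show ?case unfolding q peval_linear_mult
    using Suc.prems(2)[OF z] by (intro inv_el_mult)
qed

text \<open>A root \<open>z\<close> of \<open>z - z ^ Suc n - \<mu>\<close> satisfies
  \<open>z * (1 - z ^ n) = \<mu>\<close>, which is nonzero, so \<open>z\<close> is neither
  \<open>0\<close> nor an \<open>n\<close>-th root of unity.\<close>

lemma inv_el_diff_power:
  fixes a :: "'a::complex_banach_algebra_1"
  assumes "n > 0" "\<And>z. z \<noteq> 0 \<Longrightarrow> z ^ n \<noteq> 1 \<Longrightarrow> inv_el (a - scaleC z 1)" "\<mu> \<noteq> 0"
  shows "inv_el (a - a ^ Suc n - scaleC \<mu> 1)"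
proof -
  define p :: "complex poly" where "p = monom 1 1 - monom 1 (Suc n) - [:\<mu>:]"
  have "coeff p (Suc n) \<noteq> 0" using assms(1) by (auto simp: p_def)
  then have "p \<noteq> 0" by auto
  moreover have "inv_el (a - scaleC z 1)" if "poly p z = 0" for z
    using that assms(3) by (intro assms(2)) (auto simp: p_def poly_monom)
  ultimately have "inv_el (peval p a)" by (rule inv_el_peval)
  then show ?thesis by (simp add: p_def del: power_Suc)
qed

text \<open>The idempotent \<open>e = a * x\<close> commutes with \<open>a\<close>. The
  quasinilpotent \<open>w\<close> acts as \<open>a - a ^ Suc n\<close> on the corner of
  \<open>e\<close> and as \<open>a\<close> on the corner of \<open>1 - e\<close>. So on the first
  corner \<open>a - z\<close> divides \<open>w - \<mu>\<close> with
  \<open>\<mu> = z - z ^ Suc n\<close>, and on the second it equals \<open>w - z\<close>; both of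
  these are invertible.\<close>

lemma gpi_Hirano_imp_inv_el:
  fixes a :: "'a::complex_banach_algebra_1"
  assumes "gpi_Hirano a"
  obtains n where "n > 0" "\<And>z. z \<noteq> 0 \<Longrightarrow> z ^ n \<noteq> 1 \<Longrightarrow> inv_el (a - scaleC z 1)"
proof -
  obtain x n where x: "x * a * x = x" "a * x = x * a" and n: "n > 0"
    and q: "qnil (a - a ^ (n + 2) * x)"
    using assms by (auto simp: gpi_Hirano_def)
  define e w where "e = a * x" and "w = a - a ^ (n + 2) * x"
  have ee: "e * e = e" unfolding e_def by (metis x mult.assoc)
  have ea: "e * a = a * e" unfolding e_def by (metis x(2) mult.assoc)
  have w: "w = a - a ^ Suc n * e"
    unfolding w_def e_def by (metis add_2_eq_Suc' power_Suc2 mult.assoc)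
  define b where "b = a ^ Suc n"
  have eb: "e * b = b * e"
    unfolding b_def by (rule power_commuting_commutes[OF ea[symmetric], symmetric])
  have ebe: "e * (b * e) = b * e" by (metis eb ee mult.assoc)
  have we: "w * e = (a - b) * e" "e * w = (a - b) * e"
    and w1: "w * (1 - e) = a * (1 - e)" "(1 - e) * w = a * (1 - e)"
    unfolding w b_def[symmetric] by (simp_all add: algebra_simps ee ea ebe)
  have "inv_el (a - scaleC z 1)" if z: "z \<noteq> 0" "z ^ n \<noteq> 1" for z
  proof -
    define \<mu> where "\<mu> = z - z ^ Suc n"
    have "\<mu> \<noteq> 0" using z by (auto simp: \<mu>_def)
    with q obtain u where u: "(w - scaleC \<mu> 1) * u = 1" "u * (w - scaleC \<mu> 1) = 1"
      by (force simp: qnil_def spec_def inv_el_def w_def)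
    from q z obtain u' where u': "(w - scaleC z 1) * u' = 1" "u' * (w - scaleC z 1) = 1"
      by (force simp: qnil_def spec_def inv_el_def w_def)
    define f :: "complex poly" where "f = monom 1 1 - monom 1 (Suc n) - [:\<mu>:]"
    have "poly f z = 0" by (simp add: f_def \<mu>_def poly_monom)
    then obtain g where g: "f = [:- z, 1:] * g" by (metis dvdE poly_eq_0_iff_dvd)
    \<comment> \<open>The polynomial \<open>f\<close> vanishes at \<open>z\<close>, so
      \<open>h\<close> is the cofactor of \<open>a - z\<close> in
      \<open>a - b - \<mu>\<close>.\<close>
    define h where "h = peval g a"
    have ph: "(a - scaleC z 1) * h = a - b - scaleC \<mu> 1"
      using arg_cong[OF g, of "\<lambda>p. peval p a"]
      by (simp only: peval_linear_mult h_def) (simp add: f_def b_def del: power_Suc)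
    have hp: "h * (a - scaleC z 1) = (a - scaleC z 1) * h"
      unfolding h_def by (simp add: algebra_simps peval_commute scaleC_simps)
    show ?thesis
    \<comment> \<open>A right inverse and a left inverse are assembled separately, each as a sum
      over the two corners: \<open>h * e * u + (1 - e) * u'\<close> and
      \<open>u * e * h + u' * (1 - e)\<close>.\<close>
    proof (rule inv_elI)
      have 1: "(a - scaleC z 1) * h * e = e * (w - scaleC \<mu> 1)"
        unfolding ph by (simp add: algebra_simps scaleC_simps we)
      have 2: "(a - scaleC z 1) * (1 - e) = (1 - e) * (w - scaleC z 1)"
        using w1 by (simp add: algebra_simps scaleC_simps)
      have "(a - scaleC z 1) * (h * e * u + (1 - e) * u')
          = (a - scaleC z 1) * h * e * u + (a - scaleC z 1) * (1 - e) * u'"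
        by (simp only: distrib_left mult.assoc)
      also have "\<dots> = e * ((w - scaleC \<mu> 1) * u) + (1 - e) * ((w - scaleC z 1) * u')"
        unfolding 1 2 by (simp only: mult.assoc)
      finally show "(a - scaleC z 1) * (h * e * u + (1 - e) * u') = 1"
        by (simp add: u u')
      have "e * h * (a - scaleC z 1) = e * (a - b - scaleC \<mu> 1)"
        by (simp only: mult.assoc hp ph)
      also have "\<dots> = (w - scaleC \<mu> 1) * e"
        using we ea eb by (simp add: algebra_simps scaleC_simps)
      finally have 3: "e * h * (a - scaleC z 1) = (w - scaleC \<mu> 1) * e" .
      have 4: "(1 - e) * (a - scaleC z 1) = (w - scaleC z 1) * (1 - e)"
        using w1 ea by (simp add: algebra_simps scaleC_simps)
      have "(u * e * h + u' * (1 - e)) * (a - scaleC z 1)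
          = u * (e * h * (a - scaleC z 1)) + u' * ((1 - e) * (a - scaleC z 1))"
        by (simp only: distrib_right mult.assoc)
      also have "\<dots> = u * (w - scaleC \<mu> 1) * e + u' * (w - scaleC z 1) * (1 - e)"
        unfolding 3 4 by (simp only: mult.assoc)
      finally show "(u * e * h + u' * (1 - e)) * (a - scaleC z 1) = 1"
        by (simp add: u u')
    qed
  qed
  with n show thesis by (rule that)
qed

section \<open>Inversion and continuity\<close>

text \<open>Neumann series. Assuming summability instead of \<open>norm v < 1\<close> lets it serve
  for small, quasinilpotent and nilpotent elements alike.\<close>

lemma inv_el_one_minus:
  fixes v :: "'a::complex_banach_algebra_1"
  assumes "summable (\<lambda>n. norm (v ^ n))"
  shows "inv_el (1 - v)"
proof -
  have s: "summable (\<lambda>n. v ^ n)" by (rule summable_norm_cancel[OF assms])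
  define y where "y = (\<Sum>n. v ^ n)"
  have "v * y = y - 1" "y * v = y - 1"
    unfolding y_def using suminf_split_head[OF s]
    by (simp_all add: suminf_mult[OF s, symmetric] suminf_mult2[OF s] power_commutes)
  then show ?thesis by (intro inv_elI[of _ y y]) (auto simp: algebra_simps)
qed

lemma inv_el_diff_scaleC_large:
  fixes a :: "'a::complex_banach_algebra_1"
  assumes "norm a < cmod z"
  shows "inv_el (a - scaleC z 1)"
proof -
  have z: "z \<noteq> 0" using assms by auto
  define v where "v = scaleC (1 / z) a"
  have nv: "norm v < 1" using assms z by (simp add: v_def norm_scaleC norm_divide field_simps)
  have "summable (\<lambda>n. norm (v ^ n))"
    by (rule summable_comparison_test'[OF summable_geometric[of "norm v"], of 0])
      (use nv in \<open>auto intro: norm_power_ineq\<close>)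
  then have "inv_el (scaleC (- z) (1 - v))"
    using z by (subst inv_el_scaleC) (auto intro: inv_el_one_minus)
  then show ?thesis using z by (simp add: v_def scaleC_simps)
qed

text \<open>The resolvent identity \<open>q z - q w = q z * (h w - h z) * q w\<close> gives
  continuity once \<open>q\<close> is known to be bounded near \<open>w\<close>.\<close>

lemma continuous_on_inverse_el:
  fixes h q :: "'b::topological_space \<Rightarrow> 'a::real_normed_algebra_1"
  assumes h: "continuous_on S h" and q: "\<And>z. z \<in> S \<Longrightarrow> h z * q z = 1 \<and> q z * h z = 1"
  shows "continuous_on S q"
  unfolding continuous_on_def
proof
  fix w assume w: "w \<in> S"
  let ?F = "at w within S"
  define D where "D z = norm (h w - h z)" for z
  have D: "(D \<longlongrightarrow> 0) ?F"
  proof -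
    have "(h \<longlongrightarrow> h w) ?F" using h w by (auto simp: continuous_on_def)
    then have "((\<lambda>z. h w - h z) \<longlongrightarrow> h w - h w) ?F" by (intro tendsto_intros)
    then show ?thesis unfolding D_def by (intro tendsto_norm_zero) simp
  qed
  have diff: "norm (q z - q w) \<le> norm (q z) * D z * norm (q w)" if "z \<in> S" for z
  proof -
    have "q z * (h w - h z) * q w = q z * (h w * q w) - q z * h z * q w"
      by (simp add: algebra_simps)
    then have "q z - q w = q z * (h w - h z) * q w" using q[OF that] q[OF w] by simp
    moreover have "norm (q z * (h w - h z) * q w) \<le> norm (q z * (h w - h z)) * norm (q w)"
      by (rule norm_mult_ineq)
    moreover have "\<dots> \<le> norm (q z) * norm (h w - h z) * norm (q w)"
      by (intro mult_right_mono norm_mult_ineq) auto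
    ultimately show ?thesis unfolding D_def by simp
  qed
  have "((\<lambda>z. D z * norm (q w)) \<longlongrightarrow> 0 * norm (q w)) ?F"
    by (intro tendsto_intros D)
  then have "eventually (\<lambda>z. D z * norm (q w) < 1 / 2) ?F"
    by (rule order_tendstoD) auto
  moreover have "eventually (\<lambda>z. z \<in> S) ?F" by (simp add: eventually_at_filter)
  ultimately have "eventually (\<lambda>z. norm (q z - q w) \<le> 2 * norm (q w) * D z * norm (q w)) ?F"
  proof eventually_elim
    case (elim z)
    \<comment> \<open>Since \<open>D z * norm (q w) < 1 / 2\<close>, the identity bounds the
      increment by half of \<open>norm (q z)\<close>, which is absorbed on the left. This is the
      local bound on \<open>q\<close>.\<close>
    have "norm (q z) \<le> norm (q w) + norm (q z - q w)"
      by (metis add.commute diff_add_cancel norm_triangle_ineq)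
    also have "norm (q z - q w) \<le> norm (q z) * (D z * norm (q w))"
      using diff[OF elim(2)] by (simp add: mult.assoc)
    also have "\<dots> \<le> norm (q z) * (1 / 2)"
      using elim(1) by (intro mult_left_mono) auto
    finally have "norm (q z) \<le> 2 * norm (q w)" by simp
    then have "norm (q z) * D z * norm (q w) \<le> 2 * norm (q w) * D z * norm (q w)"
      by (intro mult_right_mono) (auto simp: D_def)
    with diff[OF elim(2)] show ?case by linarith
  qed
  moreover have "((\<lambda>z. 2 * norm (q w) * D z * norm (q w)) \<longlongrightarrow> 2 * norm (q w) * 0 * norm (q w)) ?F"
    by (intro tendsto_intros D)
  ultimately have "((\<lambda>z. q z - q w) \<longlongrightarrow> 0) ?F"
    using Lim_null_comparison[of "\<lambda>z. q z - q w" "\<lambda>z. 2 * norm (q w) * D z * norm (q w)"] by simp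
  then show "(q \<longlongrightarrow> q w) ?F" by (simp add: LIM_zero_iff)
qed

text \<open>With \<open>q\<close> the inverse of \<open>f * g\<close>, the element
  \<open>g * q\<close> is a right inverse of \<open>f\<close>, and the idempotent
  \<open>P = 1 - g * q * f\<close> measures its failure to be a left inverse. The norm of an
  idempotent is \<open>0\<close> or at least \<open>1\<close>, so by continuity \<open>P\<close>
  vanishes on all of \<open>S\<close> as soon as it vanishes at \<open>z0\<close>, where
  \<open>f\<close> is invertible.\<close>

lemma inv_el_factors_connected:
  fixes f g :: "'b::topological_space \<Rightarrow> 'a::real_normed_algebra_1"
  assumes S: "connected S" and f: "continuous_on S f" and g: "continuous_on S g"
    and fg: "\<And>z. z \<in> S \<Longrightarrow> inv_el (f z * g z)"
    and z0: "z0 \<in> S" "inv_el (f z0)" and z: "z \<in> S"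
  shows "inv_el (f z)" "inv_el (g z)"
proof -
  obtain q where q: "\<And>z. z \<in> S \<Longrightarrow> f z * g z * q z = 1 \<and> q z * (f z * g z) = 1"
    using fg unfolding inv_el_def by metis
  have cq: "continuous_on S q"
    by (rule continuous_on_inverse_el[where h = "\<lambda>z. f z * g z"]) (use q f g in \<open>auto intro: continuous_on_mult\<close>)
  define P where "P z = 1 - g z * q z * f z" for z
  have cP: "continuous_on S (\<lambda>z. norm (P z))"
    unfolding P_def by (intro continuous_intros f g cq)
  have idem: "P z * P z = P z" if "z \<in> S" for z
  proof -
    have "g z * q z * f z * (g z * q z * f z) = g z * q z * (f z * g z * q z) * f z"
      by (simp add: mult.assoc)
    also have "\<dots> = g z * q z * f z" using q[OF that] by simp
    finally show ?thesis by (simp add: P_def algebra_simps)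
  qed
  have P01: "norm (P z) = 0 \<or> norm (P z) \<ge> 1" if "z \<in> S" for z
  proof (cases "norm (P z) = 0")
    case False
    have "norm (P z) * 1 \<le> norm (P z) * norm (P z)"
      using norm_mult_ineq[of "P z" "P z"] idem[OF that] by simp
    with False show ?thesis by simp
  qed simp
  have "P z0 = 0"
  proof -
    obtain y where y: "y * f z0 = 1" using z0 by (auto simp: inv_el_def)
    have "g z0 * q z0 = y * f z0 * (g z0 * q z0)" by (simp add: y)
    also have "\<dots> = y" using q[OF z0(1)] by (simp add: mult.assoc)
    finally show ?thesis by (simp add: P_def y)
  qed
  have c: "connected ((\<lambda>z. norm (P z)) ` S)" by (rule connected_continuous_image[OF cP S])
  have "P z = 0"
  proof (rule ccontr)
    assume "P z \<noteq> 0"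
    then have "norm (P z) \<ge> 1" using P01[OF z] by auto
    have "1 / 2 \<in> (\<lambda>z. norm (P z)) ` S"
      by (rule connectedD_interval[OF c, of "norm (P z0)" "norm (P z)"])
        (use \<open>P z0 = 0\<close> \<open>norm (P z) \<ge> 1\<close> z z0 in auto)
    then show False using P01 by force
  qed
  then have gqf: "g z * (q z * f z) = 1" "g z * q z * f z = 1" by (auto simp: P_def mult.assoc)
  have "f z * (g z * q z) = 1" "q z * f z * g z = 1" using q[OF z] by (simp_all only: mult.assoc)
  with gqf show "inv_el (f z)" "inv_el (g z)" by (blast intro: inv_elI)+
qed

section \<open>Quasinilpotent elements\<close>

lemma primitive_root_of_unity:
  assumes "n > 0"
  obtains \<omega> :: complex where "\<omega> ^ n = 1" "cmod \<omega> = 1" "\<And>i. 0 < i \<Longrightarrow> i < n \<Longrightarrow> \<omega> ^ i \<noteq> 1"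
proof -
  define \<omega> where "\<omega> = exp (2 * of_real pi * \<i> / of_nat n)"
  have pow: "\<omega> ^ i = exp (2 * of_real pi * \<i> * of_nat i / of_nat n)" for i
  proof -
    have "of_nat i * (2 * of_real pi * \<i> / of_nat n) = 2 * of_real pi * \<i> * of_nat i / of_nat n"
      by simp
    then show ?thesis unfolding \<omega>_def by (metis exp_of_nat_mult)
  qed
  have root: "\<omega> ^ i = 1 \<longleftrightarrow> n dvd i" for i
    using complex_root_unity_eq_1[of n i] assms by (simp add: pow)
  show thesis
  proof
    show 1: "\<omega> ^ n = 1" by (simp add: root)
    show "cmod \<omega> = 1" using power_eq_1_iff[OF 1] assms by auto
    show "\<omega> ^ i \<noteq> 1" if "0 < i" "i < n" for i
      using that by (auto simp: root dest: dvd_imp_le)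
  qed
qed

lemma one_minus_mult_sum_power: "(1 - x) * (\<Sum>i<n. x ^ i) = 1 - (x::'a::ring_1) ^ n"
proof (induction n)
  case (Suc n)
  then have "(1 - x) * (\<Sum>i<Suc n. x ^ i) = 1 - x ^ n + (1 - x) * x ^ n"
    by (simp add: distrib_left)
  then show ?case by (simp add: left_diff_distrib)
qed simp

text \<open>Partial fractions: \<open>1 / (1 - x ^ n)\<close> is the mean of
  \<open>1 / (1 - \<omega> ^ j * x)\<close> over \<open>j < n\<close>. Each summand times
  \<open>1 - x ^ n\<close> is a finite geometric sum, and summing over \<open>j\<close> cancels
  every power of \<open>x\<close> but the zeroth.\<close>

lemma average_resolvent:
  fixes v :: "'a::complex_banach_algebra_1"
  assumes n: "n > 0"
    and \<omega>: "\<omega> ^ n = 1" "\<And>i. 0 < i \<Longrightarrow> i < n \<Longrightarrow> \<omega> ^ i \<noteq> 1"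
    and G: "\<And>\<mu>. G \<mu> * (1 - scaleC \<mu> v) = 1"
  shows "((1 / real n) *\<^sub>R (\<Sum>j<n. G (\<omega> ^ j * \<mu>))) * (1 - scaleC (\<mu> ^ n) (v ^ n)) = 1"
proof -
  define x where "x = scaleC \<mu> v"
  have xn: "scaleC (\<mu> ^ n) (v ^ n) = x ^ n" by (simp add: x_def scaleC_power)
  have "G (\<omega> ^ j * \<mu>) * (1 - x ^ n) = (\<Sum>i<n. scaleC ((\<omega> ^ i) ^ j) (x ^ i))" for j
  proof -
    define y where "y = scaleC (\<omega> ^ j * \<mu>) v"
    have y: "y = scaleC (\<omega> ^ j) x" by (simp add: y_def x_def scaleC_scaleC)
    have "(\<omega> ^ j) ^ n = 1" using \<omega>(1) by (metis mult.commute power_mult power_one)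
    then have yn: "y ^ n = x ^ n" by (simp add: y scaleC_power scaleC_one)
    have "G (\<omega> ^ j * \<mu>) * (1 - x ^ n) = G (\<omega> ^ j * \<mu>) * (1 - y) * (\<Sum>i<n. y ^ i)"
      by (simp only: mult.assoc one_minus_mult_sum_power yn)
    also have "\<dots> = (\<Sum>i<n. y ^ i)" by (simp add: y_def G)
    finally show ?thesis by (simp add: y scaleC_power mult.commute flip: power_mult)
  qed
  then have "(\<Sum>j<n. G (\<omega> ^ j * \<mu>)) * (1 - x ^ n)
      = (\<Sum>j<n. \<Sum>i<n. scaleC ((\<omega> ^ i) ^ j) (x ^ i))"
    by (simp add: sum_distrib_right)
  also have "\<dots> = (\<Sum>i<n. scaleC (\<Sum>j<n. (\<omega> ^ i) ^ j) (x ^ i))"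
    by (subst sum.swap) (simp add: scaleC_sum_left)
  also have "\<dots> = (\<Sum>i<n. if i = 0 then of_nat n else 0)"
  proof (rule sum.cong)
    fix i assume "i \<in> {..<n}"
    then have i: "i < n" by simp
    have "(\<Sum>j<n. (\<omega> ^ i) ^ j) = 0" if "i \<noteq> 0"
    proof -
      have "(\<omega> ^ i) ^ n = 1" using \<omega>(1) by (metis mult.commute power_mult power_one)
      then show ?thesis using \<omega>(2)[of i] that i by (simp add: geometric_sum)
    qed
    moreover have "scaleC (of_nat n) 1 = (of_nat n :: 'a)"
      using scaleC_of_real[of "real n" "1::'a"] by (simp add: scaleR_conv_of_real)
    ultimately show "scaleC (\<Sum>j<n. (\<omega> ^ i) ^ j) (x ^ i) = (if i = 0 then of_nat n else 0)"
      by auto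
  qed simp
  also have "\<dots> = real n *\<^sub>R 1" using n by (simp add: scaleR_conv_of_real)
  finally show ?thesis using n by (simp add: xn)
qed

text \<open>Spectral radius zero, stated through norms of powers and without taking
  \<open>n\<close>-th roots.\<close>

definition quasinilpotent :: "'a::real_normed_algebra_1 \<Rightarrow> bool" where
  "quasinilpotent v \<longleftrightarrow> (\<forall>r\<ge>0. (\<lambda>n. r ^ n * norm (v ^ n)) \<longlonglongrightarrow> 0)"

lemma tendsto_power_mult_norm_mono:
  assumes "(\<lambda>n. t ^ n * norm (v ^ n)) \<longlonglongrightarrow> 0" "0 \<le> s" "s \<le> (t::real)"
  shows "(\<lambda>n. s ^ n * norm (v ^ n :: 'a::real_normed_algebra_1)) \<longlonglongrightarrow> 0"
proof (rule Lim_null_comparison[OF always_eventually[OF allI] assms(1)])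
  show "norm (s ^ n * norm (v ^ n)) \<le> t ^ n * norm (v ^ n)" for n
    using assms(2,3) by (simp add: mult_right_mono power_mono)
qed

text \<open>Rickart's argument, which uses only continuity of the resolvent \<open>G\<close>. The
  averages \<open>F n s\<close> invert \<open>1 - (s *\<^sub>R v) ^ n\<close> and inherit from
  \<open>G\<close> a bound and a Lipschitz constant independent of \<open>n\<close>. If
  \<open>t ^ n * norm (v ^ n)\<close> tends to \<open>0\<close>, then \<open>F n t\<close> tends to
  \<open>1\<close>, so \<open>F n s\<close> stays near \<open>1\<close> for \<open>s\<close>
  slightly above \<open>t\<close>, and decay extends beyond \<open>t\<close>. The gain is the same
  for every \<open>t\<close>, so finitely many steps reach \<open>\<rho>\<close>.\<close>

lemma quasinilpotentI_resolvent:
  fixes v :: "'a::complex_banach_algebra_1"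
  assumes "\<And>\<mu>. inv_el (1 - scaleC \<mu> v)"
  shows "quasinilpotent v"
  unfolding quasinilpotent_def
proof (intro allI impI)
  fix \<rho> :: real assume \<rho>: "\<rho> \<ge> 0"
  let ?A = "\<lambda>t::real. (\<lambda>n. t ^ n * norm (v ^ n)) \<longlonglongrightarrow> 0"
  \<comment> \<open>The margin of \<open>1\<close> leaves room for the points
    \<open>t + \<delta>\<close> with \<open>t \<le> \<rho>\<close> and
    \<open>\<delta> \<le> 1\<close>.\<close>
  define R where "R = \<rho> + 1"
  obtain G where G: "\<And>\<mu>. (1 - scaleC \<mu> v) * G \<mu> = 1 \<and> G \<mu> * (1 - scaleC \<mu> v) = 1"
    using assms unfolding inv_el_def by metis
  have contG: "continuous_on (cball 0 R) G"
    by (rule continuous_on_inverse_el[where h = "\<lambda>\<mu>. 1 - scaleC \<mu> v"])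
      (use G in \<open>auto intro!: continuous_intros\<close>)
  obtain K where K: "K > 0" "\<And>\<mu>. cmod \<mu> \<le> R \<Longrightarrow> norm (G \<mu>) \<le> K"
    using compact_imp_bounded[OF compact_continuous_image[OF contG compact_cball]]
    by (auto simp: bounded_pos)
  \<comment> \<open>The summand \<open>1\<close> keeps \<open>L\<close> positive when
    \<open>v = 0\<close>, so that \<open>\<delta>\<close> can be defined by division.\<close>
  define L where "L = K * norm v * K + 1"
  have L: "L > 0" using K by (simp add: L_def add_nonneg_pos)
  have lip: "norm (G \<mu> - G \<nu>) \<le> L * cmod (\<mu> - \<nu>)" if "cmod \<mu> \<le> R" "cmod \<nu> \<le> R" for \<mu> \<nu>
  proof -
    have "G \<mu> * (scaleC (\<mu> - \<nu>) v) * G \<nu>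
        = G \<mu> * ((1 - scaleC \<nu> v) * G \<nu>) - (G \<mu> * (1 - scaleC \<mu> v)) * G \<nu>"
      by (simp add: algebra_simps scaleC_simps)
    also have "\<dots> = G \<mu> - G \<nu>" using G by simp
    finally have "norm (G \<mu> - G \<nu>) = norm (G \<mu> * (scaleC (\<mu> - \<nu>) v) * G \<nu>)" by simp
    also have "\<dots> \<le> norm (G \<mu> * (scaleC (\<mu> - \<nu>) v)) * norm (G \<nu>)" by (rule norm_mult_ineq)
    also have "\<dots> \<le> norm (G \<mu>) * norm (scaleC (\<mu> - \<nu>) v) * norm (G \<nu>)"
      by (intro mult_right_mono norm_mult_ineq) auto
    also have "\<dots> \<le> K * norm (scaleC (\<mu> - \<nu>) v) * K"
      using K that by (intro mult_mono) (auto intro: less_imp_le)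
    also have "\<dots> \<le> L * cmod (\<mu> - \<nu>)" by (simp add: L_def norm_scaleC algebra_simps)
    finally show ?thesis .
  qed
  have "\<exists>\<omega>::complex. n > 0 \<longrightarrow> \<omega> ^ n = 1 \<and> cmod \<omega> = 1 \<and> (\<forall>i. 0 < i \<longrightarrow> i < n \<longrightarrow> \<omega> ^ i \<noteq> 1)" for n
    by (metis primitive_root_of_unity)
  then obtain \<omega> :: "nat \<Rightarrow> complex" where \<omega>: "\<And>n. n > 0 \<Longrightarrow> \<omega> n ^ n = 1 \<and> cmod (\<omega> n) = 1
      \<and> (\<forall>i. 0 < i \<longrightarrow> i < n \<longrightarrow> \<omega> n ^ i \<noteq> 1)" by metis
  define F where "F n s = (1 / real n) *\<^sub>R (\<Sum>j<n. G (\<omega> n ^ j * of_real s))" for n and s :: real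
  have F: "F n s * (1 - (s *\<^sub>R v) ^ n) = 1" if "n > 0" for n s
  proof -
    have "(s *\<^sub>R v) ^ n = scaleC (of_real s ^ n) (v ^ n)"
      by (simp add: scaleC_power flip: scaleC_of_real)
    then show ?thesis unfolding F_def using average_resolvent[of n "\<omega> n" G v] that \<omega> G by metis
  qed
  have bound: "norm (w ^ j * of_real s) \<le> R"
    if "0 \<le> s" "s \<le> R" "cmod w = 1" for s :: real and w and j :: nat
    using that by (auto simp: norm_mult norm_power)
  have FK: "norm (F n s) \<le> K" if "n > 0" "0 \<le> s" "s \<le> R" for n s
  proof -
    have "norm (\<Sum>j<n. G (\<omega> n ^ j * of_real s)) \<le> real (card {..<n}) * K"
      by (rule sum_norm_bound) (use that \<omega> K bound in auto)
    then show ?thesis using that by (simp add: F_def field_simps)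
  qed
  have FL: "norm (F n s - F n t) \<le> L * \<bar>s - t\<bar>"
    if "n > 0" "0 \<le> s" "s \<le> R" "0 \<le> t" "t \<le> R" for n s t
  proof -
    have "norm (\<Sum>j<n. G (\<omega> n ^ j * of_real s) - G (\<omega> n ^ j * of_real t))
        \<le> real (card {..<n}) * (L * \<bar>s - t\<bar>)"
    proof (rule sum_norm_bound)
      fix j
      have "cmod (\<omega> n ^ j * of_real s - \<omega> n ^ j * of_real t) = \<bar>s - t\<bar>"
        using \<omega>[OF that(1)]
        by (simp add: norm_mult norm_power flip: right_diff_distrib of_real_diff)
      then show "norm (G (\<omega> n ^ j * of_real s) - G (\<omega> n ^ j * of_real t)) \<le> L * \<bar>s - t\<bar>"
        using lip[OF bound[of s "\<omega> n" j] bound[of t "\<omega> n" j]] that \<omega>[OF that(1)] by simp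
    qed
    moreover have "F n s - F n t
        = (1 / real n) *\<^sub>R (\<Sum>j<n. G (\<omega> n ^ j * of_real s) - G (\<omega> n ^ j * of_real t))"
      by (simp only: F_def sum_subtractf scaleR_diff_right)
    ultimately show ?thesis using that by (simp add: divide_le_eq mult_ac)
  qed
  \<comment> \<open>Moving by \<open>\<delta>\<close> changes \<open>F n\<close> by at most
    \<open>1 / 4\<close>, uniformly in \<open>n\<close> and in the starting point.\<close>
  define \<delta> where "\<delta> = min 1 (1 / (4 * L))"
  have \<delta>: "0 < \<delta>" "\<delta> \<le> 1" "L * \<delta> \<le> 1 / 4"
    using L by (auto simp: \<delta>_def min_def field_simps)
  have step: "?A (t + \<delta> / 2)" if t: "0 \<le> t" "t \<le> \<rho>" and A: "?A t" for t
  proof -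
    define s where "s = t + \<delta>"
    have s: "0 < s" "s \<le> R" "t \<le> R" using t \<delta> by (auto simp: s_def R_def)
    have "(\<lambda>n. K * (t ^ n * norm (v ^ n))) \<longlonglongrightarrow> K * 0" by (intro tendsto_intros A)
    then have "eventually (\<lambda>n. K * (t ^ n * norm (v ^ n)) < 1 / 4) sequentially"
      by (rule order_tendstoD) auto
    moreover have "eventually (\<lambda>n::nat. n > 0) sequentially" by (rule eventually_gt_at_top)
    ultimately have "eventually (\<lambda>n. s ^ n * norm (v ^ n) \<le> 1) sequentially"
    proof eventually_elim
      case (elim n)
      have "F n t - 1 = F n t * (t *\<^sub>R v) ^ n"
        using F[OF elim(2), of t] by (simp add: algebra_simps)
      then have "norm (F n t - 1) \<le> norm (F n t) * norm ((t *\<^sub>R v) ^ n)"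
        by (metis norm_mult_ineq)
      also have "\<dots> \<le> K * (t ^ n * norm (v ^ n))"
        using FK[OF elim(2) t(1) s(3)] t K(1) by (auto simp: power_abs scaleR_power intro!: mult_mono)
      finally have 1: "norm (F n t - 1) \<le> 1 / 4" using elim by simp
      have "norm (F n s - F n t) \<le> L * \<delta>"
        using FL[OF elim(2) _ s(2) t(1) s(3)] s \<delta> by (simp add: s_def)
      then have 2: "norm (F n s - 1) \<le> 1 / 2"
        using 1 \<delta>(3) norm_triangle_ineq[of "F n s - F n t" "F n t - 1"] by simp
      define y where "y = (s *\<^sub>R v) ^ n"
      \<comment> \<open>As \<open>F n s\<close> is within \<open>1 / 2\<close> of \<open>1\<close>,
        this gives \<open>norm y \<le> (1 + norm y) / 2\<close>, hence
        \<open>norm y \<le> 1\<close>.\<close>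
      have "y = (F n s - 1) * (1 - y)"
        using F[OF elim(2), of s] by (simp add: left_diff_distrib y_def)
      then have "norm y \<le> norm (F n s - 1) * norm (1 - y)" by (metis norm_mult_ineq)
      also have "\<dots> \<le> (1 / 2) * (1 + norm y)"
        using 2 norm_triangle_ineq4[of 1 y] by (intro mult_mono) auto
      finally have "norm y \<le> 1" by simp
      then show ?case using s by (simp add: y_def scaleR_power power_abs)
    qed
    \<comment> \<open>At \<open>s\<close> there is only boundedness; retreating to the midpoint of
      \<open>t\<close> and \<open>s\<close> gains a geometric factor and so decay.\<close>
    then have "eventually (\<lambda>n. norm ((t + \<delta> / 2) ^ n * norm (v ^ n)) \<le> ((t + \<delta> / 2) / s) ^ n) sequentially"
    proof eventually_elim
      case (elim n)
      have "(t + \<delta> / 2) ^ n * norm (v ^ n) = ((t + \<delta> / 2) / s) ^ n * (s ^ n * norm (v ^ n))"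
        using s by (simp add: power_divide)
      also have "\<dots> \<le> ((t + \<delta> / 2) / s) ^ n * 1"
        using elim s t \<delta> by (intro mult_left_mono) auto
      finally show ?case using t \<delta> by simp
    qed
    moreover have "(\<lambda>n. ((t + \<delta> / 2) / s) ^ n) \<longlonglongrightarrow> 0"
      using s t \<delta> by (intro LIMSEQ_realpow_zero) (auto simp: s_def field_simps)
    ultimately show ?thesis by (rule Lim_null_comparison)
  qed
  \<comment> \<open>The minimum keeps every starting point in the range
    \<open>t \<le> \<rho>\<close> where \<open>step\<close> applies.\<close>
  have "?A (min \<rho> (real j * (\<delta> / 2)))" for j
  proof (induction j)
    case 0
    \<comment> \<open>Shifted by one because \<open>0 ^ 0 = 1\<close>.\<close>
    have "(\<lambda>n. 0 ^ Suc n * norm (v ^ Suc n)) \<longlonglongrightarrow> 0" by simp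
    then have "?A 0" by (rule LIMSEQ_imp_Suc)
    then show ?case using \<rho> by simp
  next
    case (Suc j)
    have "?A (min \<rho> (real j * (\<delta> / 2)) + \<delta> / 2)"
      using \<rho> \<delta> by (intro step Suc) auto
    then show ?case
      by (rule tendsto_power_mult_norm_mono) (use \<rho> \<delta> in \<open>auto simp: min_def distrib_right\<close>)
  qed
  moreover obtain j where "\<rho> < real j * (\<delta> / 2)"
    using reals_Archimedean3[of "\<delta> / 2", THEN spec, of \<rho>] \<delta>(1) by (meson half_gt_zero)
  moreover from this have "min \<rho> (real j * (\<delta> / 2)) = \<rho>" by simp
  ultimately show "?A \<rho>" by metis
qed

section \<open>Products, summability and spectrum of quasinilpotent elements\<close>

lemma power_mult_distrib_commute:
  assumes "x * y = y * (x::'a::monoid_mult)"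
  shows "(x * y) ^ n = x ^ n * y ^ n"
proof (induction n)
  case (Suc n)
  have "y * x ^ n = x ^ n * y" by (rule power_commuting_commutes[OF assms, symmetric])
  then have "x * y * (x ^ n * y ^ n) = x * (x ^ n * y) * y ^ n" by (metis mult.assoc)
  then show ?case by (simp add: Suc mult.assoc)
qed simp

text \<open>By commutation \<open>(v * y) ^ n = v ^ n * y ^ n\<close>, and \<open>norm y ^ n\<close>
  is absorbed by replacing \<open>r\<close> with \<open>r * norm y\<close>.\<close>

lemma quasinilpotent_mult:
  assumes "quasinilpotent v" "v * y = y * v"
  shows "quasinilpotent (v * y)"
  unfolding quasinilpotent_def
proof (intro allI impI)
  fix r :: real assume r: "r \<ge> 0"
  have lim: "(\<lambda>n. (r * norm y) ^ n * norm (v ^ n)) \<longlonglongrightarrow> 0"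
    using assms(1) r by (simp add: quasinilpotent_def)
  have le: "norm (r ^ n * norm ((v * y) ^ n)) \<le> (r * norm y) ^ n * norm (v ^ n)" for n
  proof -
    have "norm ((v * y) ^ n) \<le> norm (v ^ n) * norm (y ^ n)"
      unfolding power_mult_distrib_commute[OF assms(2)] by (rule norm_mult_ineq)
    also have "\<dots> \<le> norm (v ^ n) * norm y ^ n" by (intro mult_left_mono norm_power_ineq) auto
    finally show ?thesis
      using r by (simp add: power_mult_distrib mult_left_mono mult_ac)
  qed
  show "(\<lambda>n. r ^ n * norm ((v * y) ^ n)) \<longlonglongrightarrow> 0"
    by (rule Lim_null_comparison[OF always_eventually[OF allI[OF le]] lim])
qed

lemma quasinilpotent_summable:
  assumes "quasinilpotent v" "r \<ge> 0"
  shows "summable (\<lambda>n. r ^ n * norm (v ^ n))"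
proof -
  \<comment> \<open>Decay at the doubled scale yields a geometric majorant of ratio
    \<open>1 / 2\<close> at scale \<open>r\<close>.\<close>
  have "(\<lambda>n. (2 * r) ^ n * norm (v ^ n)) \<longlonglongrightarrow> 0"
    using assms(1)[unfolded quasinilpotent_def, rule_format, of "2 * r"] assms(2) by simp
  then have "eventually (\<lambda>n. (2 * r) ^ n * norm (v ^ n) < 1) sequentially"
    by (rule order_tendstoD) auto
  then have "eventually (\<lambda>n. norm (r ^ n * norm (v ^ n)) \<le> (1 / 2) ^ n) sequentially"
    by eventually_elim (use assms in \<open>simp add: power_mult_distrib power_divide field_simps\<close>)
  then show ?thesis by (rule summable_comparison_test_ev) (simp add: summable_geometric)
qed

lemma quasinilpotent_inv_el_one_minus:
  "quasinilpotent v \<Longrightarrow> inv_el (1 - (v::'a::complex_banach_algebra_1))"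
  using quasinilpotent_summable[of v 1] by (simp add: inv_el_one_minus)

text \<open>Otherwise \<open>1\<close>, as the product of \<open>v\<close> and its inverse, would be
  quasinilpotent. This puts \<open>0\<close> into the spectrum, as \<open>qnil\<close> demands
  equality with \<open>{0}\<close>.\<close>

lemma quasinilpotent_not_inv_el:
  assumes "quasinilpotent (v::'a::real_normed_algebra_1)"
  shows "\<not> inv_el v"
proof
  assume "inv_el v"
  then obtain y where y: "v * y = 1" "y * v = 1" by (auto simp: inv_el_def)
  then have "quasinilpotent (1 :: 'a)" using quasinilpotent_mult[OF assms, of y] by simp
  then have "(\<lambda>n. 1 ^ n * norm (1 ^ n :: 'a)) \<longlonglongrightarrow> 0"
    unfolding quasinilpotent_def by (metis zero_le_one)
  then show False by (simp add: LIMSEQ_const_iff)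
qed

lemma quasinilpotent_imp_qnil:
  fixes v :: "'a::complex_banach_algebra_1"
  assumes "quasinilpotent v"
  shows "qnil v"
proof -
  have "inv_el (v - scaleC z 1)" if "z \<noteq> 0" for z
  proof -
    have "quasinilpotent (v * scaleC (1 / z) 1)"
      by (rule quasinilpotent_mult[OF assms]) (simp add: scaleC_simps)
    then have "inv_el (scaleC (- z) (1 - v * scaleC (1 / z) 1))"
      using that by (subst inv_el_scaleC) (auto intro: quasinilpotent_inv_el_one_minus)
    then show ?thesis using that by (simp add: scaleC_simps)
  qed
  then show ?thesis using quasinilpotent_not_inv_el[OF assms] by (auto simp: qnil_def spec_def)
qed

section \<open>Lifting idempotents modulo a quasinilpotent\<close>

lemma suminf_commute:
  fixes f :: "nat \<Rightarrow> 'a::real_normed_algebra"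
  assumes "summable f" "\<And>n. b * f n = f n * b"
  shows "b * (\<Sum>n. f n) = (\<Sum>n. f n) * b"
  using assms by (simp add: suminf_mult2 flip: suminf_mult)

lemma commute_scaled_power:
  fixes b :: "'a::real_algebra_1"
  assumes "b * q = q * b"
  shows "b * (c *\<^sub>R q ^ n) = (c *\<^sub>R q ^ n) * b"
  using power_commuting_commutes[OF assms[symmetric], of n] by simp

lemma quasinilpotent_summable_series:
  fixes q :: "'a::real_normed_algebra_1"
  assumes q: "quasinilpotent q" and f: "\<And>k. \<bar>f k\<bar> \<le> C * r ^ k" and r: "r \<ge> 0"
  shows "summable (\<lambda>k. norm (f k *\<^sub>R q ^ k))"
proof (rule summable_comparison_test'[of _ 0])
  show "summable (\<lambda>k. C * (r ^ k * norm (q ^ k)))"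
    by (intro summable_mult quasinilpotent_summable q r)
  show "norm (norm (f k *\<^sub>R q ^ k)) \<le> C * (r ^ k * norm (q ^ k))" for k
    using mult_right_mono[OF f[of k], of "norm (q ^ k)"] by (simp add: mult.assoc)
qed

text \<open>The Taylor coefficients of \<open>(1 - 4 * x)\<close> to the power
  \<open>- 1 / 2\<close>, that is, the central binomial coefficients.\<close>

definition inv_sqrt_coeff :: "nat \<Rightarrow> real" where
  "inv_sqrt_coeff k = ((- 1 / 2) gchoose k) * (- 4) ^ k"

lemma abs_inv_sqrt_coeff_le: "\<bar>inv_sqrt_coeff k\<bar> \<le> 4 ^ k"
proof -
  have "\<bar>(- 1 / 2 :: real) gchoose k\<bar> \<le> 1"
  proof (induction k)
    case (Suc k)
    have "(1 + real k) * ((- 1 / 2) gchoose Suc k) = (- 1 / 2 - real k) * ((- 1 / 2) gchoose k)"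
      using gbinomial_mult_1[of "- 1 / 2 :: real" k] by (simp add: algebra_simps)
    then have "(1 + real k) * \<bar>(- 1 / 2) gchoose Suc k\<bar> = \<bar>- 1 / 2 - real k\<bar> * \<bar>(- 1 / 2) gchoose k\<bar>"
      by (metis abs_mult abs_of_nonneg add_nonneg_nonneg of_nat_0_le_iff zero_le_one)
    also have "\<dots> \<le> (1 + real k) * 1" using Suc by (intro mult_mono) auto
    finally show ?case by (simp add: add_nonneg_pos)
  qed simp
  then show ?thesis by (simp add: inv_sqrt_coeff_def abs_mult power_abs mult_left_le_one_le)
qed

text \<open>Vandermonde's identity with \<open>- 1 / 2 - 1 / 2 = - 1\<close>: the square of the
  series is the geometric series of \<open>4 * x\<close>.\<close>

lemma inv_sqrt_coeff_convolution:
  "(\<Sum>i\<le>k. inv_sqrt_coeff i * inv_sqrt_coeff (k - i)) = 4 ^ k"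
proof -
  have "(\<Sum>i\<le>k. inv_sqrt_coeff i * inv_sqrt_coeff (k - i))
      = (\<Sum>i\<le>k. (- 4) ^ k * (((- 1 / 2) gchoose i) * ((- 1 / 2) gchoose (k - i))))"
    by (intro sum.cong) (auto simp: inv_sqrt_coeff_def mult_ac simp flip: power_add)
  also have "\<dots> = (- 4) ^ k * ((- 1) gchoose k)"
    using gbinomial_Vandermonde[of "- 1 / 2 :: real" "- 1 / 2" k]
    by (simp add: atLeast0AtMost flip: sum_distrib_left)
  also have "(- 1 :: real) gchoose k = (- 1) ^ k"
    by (subst gbinomial_negated_upper) (simp flip: binomial_gbinomial)
  finally show ?thesis by (simp flip: power_mult_distrib)
qed

text \<open>The binomial series at \<open>q\<close> converges because its coefficients grow only
  geometrically. Its constant term is \<open>1\<close>, so it has the form \<open>1 + q * T\<close>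
  with \<open>T\<close> the shifted series; this form later makes the lifted idempotent differ from
  \<open>p\<close> by a multiple of \<open>q\<close>.\<close>

lemma quasinilpotent_inv_sqrt:
  fixes q :: "'a::complex_banach_algebra_1"
  assumes q: "quasinilpotent q"
  obtains T where "(1 - 4 *\<^sub>R q) * ((1 + q * T) * (1 + q * T)) = 1"
    "\<And>b. b * q = q * b \<Longrightarrow> b * T = T * b"
proof -
  let ?f = "\<lambda>k. inv_sqrt_coeff k *\<^sub>R q ^ k" and ?g = "\<lambda>k. inv_sqrt_coeff (Suc k) *\<^sub>R q ^ k"
  have nf: "summable (\<lambda>k. norm (?f k))"
    by (rule quasinilpotent_summable_series[OF q, of _ 1 4]) (auto simp: abs_inv_sqrt_coeff_le)
  have "summable (\<lambda>k. norm (?g k))"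
    by (rule quasinilpotent_summable_series[OF q, of _ 4 4])
      (use abs_inv_sqrt_coeff_le[of "Suc _"] in auto)
  then have g: "summable ?g" by (rule summable_norm_cancel)
  define S T where "S = (\<Sum>k. ?f k)" and "T = (\<Sum>k. ?g k)"
  have f: "summable ?f" using nf by (rule summable_norm_cancel)
  have "q * T = (\<Sum>k. ?f (Suc k))" unfolding T_def by (simp add: suminf_mult[OF g, symmetric])
  also have "\<dots> = S - 1"
    unfolding S_def using suminf_split_head[OF f] by (simp add: inv_sqrt_coeff_def)
  finally have S: "S = 1 + q * T" by simp
  let ?h = "\<lambda>k. (4 *\<^sub>R q) ^ k"
  have h: "summable ?h"
    using quasinilpotent_summable_series[OF q, of "\<lambda>k. 4 ^ k" 1 4]
    by (intro summable_norm_cancel[of ?h]) (simp add: scaleR_power)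
  have "?h k = (\<Sum>i\<le>k. ?f i * ?f (k - i))" for k
    by (simp add: scaleR_power flip: inv_sqrt_coeff_convolution[of k] power_add scaleR_sum_left)
      (simp add: mult.commute)
  then have SS: "S * S = (\<Sum>k. ?h k)"
    using Cauchy_product_sums[OF nf nf] by (simp add: S_def sums_iff)
  have "4 *\<^sub>R q * (S * S) = S * S - 1"
    unfolding SS using suminf_mult[OF h, of "4 *\<^sub>R q"] suminf_split_head[OF h] by (simp only: power_Suc power_0)
  then have "(1 - 4 *\<^sub>R q) * (S * S) = 1" by (simp add: left_diff_distrib)
  moreover have "b * T = T * b" if "b * q = q * b" for b
    unfolding T_def by (intro suminf_commute g commute_scaled_power that)
  ultimately show thesis using that S by blast
qed

text \<open>
  The idempotent is \<open>(1 + u) / 2\<close> for the involution \<open>u = (2 p - 1) (1 - 4 q)\<^sup>-\<^sup>1\<^sup>/\<^sup>2\<close>,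
  which exists because \<open>(2 p - 1)\<^sup>2 = 1 - 4 q\<close>.
\<close>
lemma idempotent_lift:
  fixes p q :: "'a::complex_banach_algebra_1"
  assumes q_def: "q = p - p * p" and q: "quasinilpotent q"
  obtains t where "(p + q * t) * (p + q * t) = p + q * t"
    "\<And>b. b * p = p * b \<Longrightarrow> b * t = t * b"
proof -
  obtain T where T: "(1 - 4 *\<^sub>R q) * ((1 + q * T) * (1 + q * T)) = 1"
    and comm: "\<And>b. b * q = q * b \<Longrightarrow> b * T = T * b"
    by (rule quasinilpotent_inv_sqrt[OF q]) blast
  define m S where "m = 2 *\<^sub>R p - 1" and "S = 1 + q * T"
  have bq: "b * q = q * b" if "b * p = p * b" for b
  proof -
    have "b * (p * p) = p * p * b" using that by (metis mult.assoc)
    then show ?thesis using that by (simp add: q_def right_diff_distrib left_diff_distrib)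
  qed
  have mq: "m * q = q * m" by (simp add: m_def q_def algebra_simps)
  have mS: "m * S = S * m"
    using comm[OF mq] mq by (simp add: S_def algebra_simps) (metis mult.assoc)
  have "m * m = 1 - 4 *\<^sub>R q"
    by (simp add: m_def q_def algebra_simps flip: scaleR_add_left)
  then have "m * m * (S * S) = 1" using T by (simp add: S_def)
  then have u: "(m * S) * (m * S) = 1" using mS by (metis mult.assoc)
  \<comment> \<open>Since \<open>m * S = m + q * (m * T)\<close> and
    \<open>m = 2 *\<^sub>R p - 1\<close>, half of \<open>1 + m * S\<close> is \<open>p\<close> plus
    \<open>q\<close> times this element.\<close>
  define t where "t = (1 / 2) *\<^sub>R (m * T)"
  have e: "p + q * t = (1 / 2) *\<^sub>R (1 + m * S)"
  proof -
    have "m * S = m + q * (m * T)" using mq by (simp add: S_def algebra_simps) (metis mult.assoc)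
    then show ?thesis by (simp add: t_def scaleR_add_right m_def scaleR_diff_right)
  qed
  show thesis
  proof
    show "(p + q * t) * (p + q * t) = p + q * t"
      unfolding e using u by (simp add: algebra_simps flip: scaleR_add_left)
    show "b * t = t * b" if "b * p = p * b" for b
    proof -
      have "b * m = m * b" using that by (simp add: m_def algebra_simps)
      moreover have "b * T = T * b" by (intro comm bq that)
      ultimately have "b * (m * T) = m * T * b" by (metis mult.assoc)
      then show ?thesis by (simp add: t_def)
    qed
  qed
qed

text \<open>The elements \<open>v = a - a ^ Suc n\<close> and \<open>q = p - p * p\<close> with
  \<open>p = a ^ n\<close> are quasinilpotent, the latter being \<open>v * a ^ l\<close> for
  \<open>n = Suc l\<close>. Lifting \<open>p\<close> gives an idempotent \<open>e\<close> on whose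
  corner \<open>p\<close>, hence \<open>a\<close>, is invertible; the inverse of \<open>a\<close> in
  that corner is the required \<open>x\<close>.\<close>

lemma inv_el_imp_gpi_Hirano:
  fixes a :: "'a::complex_banach_algebra_1"
  assumes n: "n > 0" and inv: "\<And>z. z \<noteq> 0 \<Longrightarrow> z ^ n \<noteq> 1 \<Longrightarrow> inv_el (a - scaleC z 1)"
  shows "gpi_Hirano a"
proof -
  define v where "v = a - a ^ Suc n"
  have v: "quasinilpotent v"
  proof (rule quasinilpotentI_resolvent)
    fix \<mu> :: complex
    show "inv_el (1 - scaleC \<mu> v)"
    proof (cases "\<mu> = 0")
      case False
      then have "inv_el (v - scaleC (1 / \<mu>) 1)"
        unfolding v_def by (intro inv_el_diff_power[OF n inv]) auto
      then have "inv_el (scaleC (- \<mu>) (v - scaleC (1 / \<mu>) 1))"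
        using False by (subst inv_el_scaleC) auto
      then show ?thesis using False by (simp add: scaleC_simps)
    qed (auto simp: inv_el_def)
  qed
  define p q where "p = a ^ n" and "q = p - p * p"
  obtain l where l: "n = Suc l" using n by (metis gr0_implies_Suc)
  have al: "a * a ^ l = p" "a ^ l * a = p" by (simp_all add: p_def l power_commutes)
  have ap: "a * p = p * a" by (simp add: p_def power_commutes)
  have va: "v = a * (1 - p)" by (simp add: v_def p_def algebra_simps)
  have qv: "q = v * a ^ l" "q = a ^ l * v"
  proof -
    have "a ^ l * v = q" unfolding va mult.assoc[symmetric] al by (simp add: q_def algebra_simps)
    moreover have "v * a = a * v" by (simp add: va algebra_simps flip: ap)
    then have "v * a ^ l = a ^ l * v" by (metis power_commuting_commutes)
    ultimately show "q = v * a ^ l" "q = a ^ l * v" by simp_all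
  qed
  have q: "quasinilpotent q" unfolding qv(1) by (rule quasinilpotent_mult[OF v]) (use qv in simp)
  obtain t where idem: "(p + q * t) * (p + q * t) = p + q * t"
    and t: "\<And>b. b * p = p * b \<Longrightarrow> b * t = t * b"
    by (rule idempotent_lift[OF q_def q]) blast
  define e where "e = p + q * t"
  have at: "a * t = t * a" and pt: "p * t = t * p" using ap by (auto intro: t)
  have "a * (p * p) = p * p * a" using ap by (metis mult.assoc)
  then have aq: "a * q = q * a" using ap by (simp add: q_def right_diff_distrib left_diff_distrib)
  have pq: "p * q = q * p" by (simp add: q_def algebra_simps)
  have qt: "q * t = t * q" by (rule t) (rule pq[symmetric])
  \<comment> \<open>From \<open>p = e - q * t\<close> it follows that \<open>p\<close> acts as
    \<open>y0\<close> on the corner of \<open>e\<close>, and \<open>y0\<close> is invertible because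
    \<open>q * t\<close> is quasinilpotent.\<close>
  define y0 where "y0 = 1 - q * t"
  have "inv_el y0" unfolding y0_def
    by (intro quasinilpotent_inv_el_one_minus quasinilpotent_mult q qt)
  then obtain y where y: "y0 * y = 1" "y * y0 = 1" by (auto simp: inv_el_def)
  have ycomm: "b * y = y * b" if "b * y0 = y0 * b" for b
    using that y by (metis mult.assoc mult_1_left mult_1_right)
  have aqt: "a * (q * t) = q * t * a" using aq at by (metis mult.assoc)
  have pqt: "p * (q * t) = q * t * p" using pq pt by (metis mult.assoc)
  have ae: "a * e = e * a" by (simp add: e_def distrib_left distrib_right ap aqt)
  have ee: "e * e = e" using idem by (simp add: e_def)
  have ay: "a * y = y * a" by (rule ycomm) (simp add: y0_def right_diff_distrib left_diff_distrib aqt)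
  have py: "p * y = y * p" by (rule ycomm) (simp add: y0_def right_diff_distrib left_diff_distrib pqt)
  have ey: "e * y = y * e"
    by (rule ycomm) (simp add: y0_def e_def right_diff_distrib left_diff_distrib distrib_left distrib_right pqt)
  have pe: "p * e = y0 * e"
  proof -
    have "p = e - q * t" by (simp add: e_def)
    then have "p * e = e * e - q * t * e" by (metis left_diff_distrib)
    then show ?thesis by (simp add: ee y0_def left_diff_distrib)
  qed
  \<comment> \<open>One factor \<open>a\<close> turns \<open>a ^ l\<close> into \<open>p\<close>,
    which \<open>y\<close> inverts on the corner of \<open>e\<close>; hence
    \<open>a * x = e\<close>.\<close>
  define x where "x = a ^ l * (y * e)"
  have ax: "a * x = e"
  proof -
    have "a * x = p * y * e" by (simp add: x_def al flip: mult.assoc)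
    also have "\<dots> = y * (p * e)" by (simp add: py mult.assoc)
    also have "\<dots> = e" by (simp add: pe y flip: mult.assoc)
    finally show ?thesis .
  qed
  have "a ^ l * (y * e) * a = a * (a ^ l * (y * e))"
    using ay ae by (metis mult.assoc power_commutes)
  then have xa: "x * a = a * x" by (simp add: x_def)
  have "a ^ l * e = e * a ^ l" using ae by (metis power_commuting_commutes)
  then have "e * x = x" unfolding x_def using ey ee by (metis mult.assoc)
  then have xax: "x * a * x = x" by (simp add: xa ax)
  \<comment> \<open>The left side is \<open>a * (1 - p * e)\<close>. Splitting off
    \<open>1 - p\<close> exposes \<open>v = a * (1 - p)\<close> times an element commuting with
    it.\<close>
  have "a - a ^ (n + 2) * x = v * (1 - p * t * (1 - e))"
  proof -
    have "a ^ (n + 2) = a * p * a" by (simp add: p_def power_commutes mult.assoc)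
    then have "a ^ (n + 2) * x = a * (p * e)" by (simp add: mult.assoc ax)
    moreover have "1 - p * e = (1 - p) * (1 - p * t * (1 - e))"
    proof -
      have "(1 - p) * (1 - p * t * (1 - e)) = 1 - p - (p - p * p) * t * (1 - e)"
        by (simp add: algebra_simps)
      also have "\<dots> = 1 - (p + q * t) + q * t * e" by (simp add: q_def[symmetric] algebra_simps)
      also have "\<dots> = 1 - (1 - q * t) * e" by (simp add: e_def[symmetric] left_diff_distrib)
      finally show ?thesis using pe by (simp add: y0_def)
    qed
    ultimately have "a - a ^ (n + 2) * x = a * ((1 - p) * (1 - p * t * (1 - e)))"
      by (metis mult_1_right right_diff_distrib)
    then show ?thesis by (simp add: va mult.assoc)
  qed
  moreover have "quasinilpotent (v * (1 - p * t * (1 - e)))"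
  proof (rule quasinilpotent_mult[OF v])
    have comm: "v * b = b * v" if "a * b = b * a" for b
    proof -
      have "p * b = b * p" unfolding p_def by (rule power_commuting_commutes[OF that])
      then show ?thesis unfolding va using that
        by (metis (no_types, lifting) left_diff_distrib mult.assoc mult_1_left mult_1_right right_diff_distrib)
    qed
    have "a * (p * t) = p * t * a" using ap at by (metis mult.assoc)
    moreover have "a * (1 - e) = (1 - e) * a" using ae by (simp add: algebra_simps)
    ultimately have "a * (p * t * (1 - e)) = p * t * (1 - e) * a" by (metis mult.assoc)
    then show "v * (1 - p * t * (1 - e)) = (1 - p * t * (1 - e)) * v"
      by (intro comm) (simp add: right_diff_distrib left_diff_distrib)
  qed
  ultimately have "qnil (a - a ^ (n + 2) * x)" by (simp only: quasinilpotent_imp_qnil)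
  then show ?thesis unfolding gpi_Hirano_def using xax xa n by metis
qed

section \<open>The Banach algebra of 2 x 2 matrices\<close>

text \<open>A copy of the matrix type that can carry the matrix product and a submultiplicative
  norm, so that the results on Banach algebras apply to matrices.\<close>

typedef (overloaded) 'a m2 = "UNIV :: ('a^2^2) set" ..

setup_lifting type_definition_m2

instantiation m2 :: (ring_1) ring_1
begin

lift_definition zero_m2 :: "'a m2" is 0 .
lift_definition one_m2 :: "'a m2" is "mat 1" .
lift_definition plus_m2 :: "'a m2 \<Rightarrow> 'a m2 \<Rightarrow> 'a m2" is "(+)" .
lift_definition minus_m2 :: "'a m2 \<Rightarrow> 'a m2 \<Rightarrow> 'a m2" is "(-)" .
lift_definition uminus_m2 :: "'a m2 \<Rightarrow> 'a m2" is uminus .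
lift_definition times_m2 :: "'a m2 \<Rightarrow> 'a m2 \<Rightarrow> 'a m2" is "(**)" .

instance
proof
  show "(0::'a m2) \<noteq> 1" by transfer (auto simp: vec_eq_iff mat_def)
qed (transfer; simp add: vec_eq_iff matrix_matrix_mult_def mat_def sum_2 forall_2 algebra_simps)+

end

text \<open>The maximal row sum: it is submultiplicative and gives the identity matrix norm
  \<open>1\<close>.\<close>

definition m2_norm :: "'a::real_normed_vector^2^2 \<Rightarrow> real" where
  "m2_norm M = max (norm (M $ 1 $ 1) + norm (M $ 1 $ 2)) (norm (M $ 2 $ 1) + norm (M $ 2 $ 2))"

lemma norm_entry_le_m2_norm: "norm (M $ i $ j) \<le> m2_norm M"
  using exhaust_2[of i] exhaust_2[of j] by (auto simp: m2_norm_def le_max_iff_disj)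

lemma m2_norm_mult:
  fixes M N :: "'a::real_normed_algebra_1^2^2"
  shows "m2_norm (M ** N) \<le> m2_norm M * m2_norm N"
proof -
  have row: "norm ((M ** N) $ i $ 1) + norm ((M ** N) $ i $ 2) \<le> m2_norm M * m2_norm N" for i
  proof -
    have e: "norm ((M ** N) $ i $ j) \<le> norm (M $ i $ 1) * norm (N $ 1 $ j) + norm (M $ i $ 2) * norm (N $ 2 $ j)"
      for j
      by (simp add: matrix_matrix_mult_def sum_2)
        (meson add_mono norm_mult_ineq norm_triangle_ineq order_trans)
    have "norm ((M ** N) $ i $ 1) + norm ((M ** N) $ i $ 2)
        \<le> norm (M $ i $ 1) * (norm (N $ 1 $ 1) + norm (N $ 1 $ 2))
          + norm (M $ i $ 2) * (norm (N $ 2 $ 1) + norm (N $ 2 $ 2))"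
      using e[of 1] e[of 2] by (simp add: algebra_simps)
    also have "\<dots> \<le> norm (M $ i $ 1) * m2_norm N + norm (M $ i $ 2) * m2_norm N"
      by (intro add_mono mult_left_mono) (auto simp: m2_norm_def)
    also have "\<dots> = (norm (M $ i $ 1) + norm (M $ i $ 2)) * m2_norm N" by (simp add: algebra_simps)
    also have "\<dots> \<le> m2_norm M * m2_norm N"
      using exhaust_2[of i] by (intro mult_right_mono) (auto simp: m2_norm_def le_max_iff_disj)
    finally show ?thesis .
  qed
  show ?thesis using row[of 1] row[of 2] by (simp add: m2_norm_def[of "M ** N"])
qed

instantiation m2 :: (real_normed_algebra_1) real_normed_algebra_1
begin

lift_definition scaleR_m2 :: "real \<Rightarrow> 'a m2 \<Rightarrow> 'a m2" is "(*\<^sub>R)" .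
lift_definition norm_m2 :: "'a m2 \<Rightarrow> real" is m2_norm .
definition dist_m2 :: "'a m2 \<Rightarrow> 'a m2 \<Rightarrow> real" where "dist_m2 M N = norm (M - N)"
definition sgn_m2 :: "'a m2 \<Rightarrow> 'a m2" where "sgn_m2 M = scaleR (inverse (norm M)) M"
definition uniformity_m2 :: "('a m2 \<times> 'a m2) filter" where
  "uniformity_m2 = (INF e\<in>{0<..}. principal {(M, N). dist M N < e})"
definition open_m2 :: "'a m2 set \<Rightarrow> bool" where
  "open_m2 U \<longleftrightarrow> (\<forall>x\<in>U. eventually (\<lambda>(x', y). x' = x \<longrightarrow> y \<in> U) uniformity)"

instance
proof
  fix M N :: "'a m2" and r s :: real
  show "dist M N = norm (M - N)" by (rule dist_m2_def)
  show "sgn M = scaleR (inverse (norm M)) M" by (rule sgn_m2_def)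
  show "uniformity = (INF e\<in>{0<..}. principal {(M, N :: 'a m2). dist M N < e})"
    by (rule uniformity_m2_def)
  show "open U \<longleftrightarrow> (\<forall>x\<in>U. eventually (\<lambda>(x', y). x' = x \<longrightarrow> y \<in> U) uniformity)" for U :: "'a m2 set"
    by (rule open_m2_def)
  show "norm M = 0 \<longleftrightarrow> M = 0"
  proof transfer
    fix M :: "'a^2^2"
    show "m2_norm M = 0 \<longleftrightarrow> M = 0"
    proof
      assume "m2_norm M = 0"
      then show "M = 0" using norm_entry_le_m2_norm[of M] by (simp add: vec_eq_iff)
    qed (simp add: m2_norm_def)
  qed
  show "norm (M + N) \<le> norm M + norm N"
  proof transfer
    fix M N :: "'a^2^2"
    have e: "norm ((M + N) $ i $ j) \<le> norm (M $ i $ j) + norm (N $ i $ j)" for i j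
      by (simp add: norm_triangle_ineq)
    show "m2_norm (M + N) \<le> m2_norm M + m2_norm N"
      using e[of 1 1] e[of 1 2] e[of 2 1] e[of 2 2] by (simp add: m2_norm_def max_def)
  qed
  show "norm (r *\<^sub>R M) = \<bar>r\<bar> * norm M"
    by transfer (simp add: m2_norm_def max_mult_distrib_left flip: distrib_left)
  show "norm (M * N) \<le> norm M * norm N" by transfer (rule m2_norm_mult)
  show "norm (1 :: 'a m2) = 1" by transfer (simp add: m2_norm_def mat_def)
qed (transfer; simp add: vec_eq_iff matrix_matrix_mult_def sum_2 algebra_simps)+

end

lemma norm_m2_le_sum:
  "norm M \<le> norm (Rep_m2 M $ 1 $ 1) + norm (Rep_m2 M $ 1 $ 2) + norm (Rep_m2 M $ 2 $ 1) + norm (Rep_m2 M $ 2 $ 2)"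
  by transfer (simp add: m2_norm_def)

lemma norm_entry_le_norm_m2: "norm (Rep_m2 M $ i $ j) \<le> norm M"
  by transfer (rule norm_entry_le_m2_norm)

text \<open>Completeness is inherited entrywise: the norm dominates each entry and is at most the
  sum of the four entry norms.\<close>

instance m2 :: ("{real_normed_algebra_1, banach}") banach
proof
  fix X :: "nat \<Rightarrow> 'a m2" assume X: "Cauchy X"
  have entry: "norm (Rep_m2 M $ i $ j - Rep_m2 N $ i $ j) \<le> norm (M - N)" for M N :: "'a m2" and i j
    using norm_entry_le_norm_m2[of "M - N" i j] by (simp add: minus_m2.rep_eq)
  have "Cauchy (\<lambda>n. Rep_m2 (X n) $ i $ j)" for i j
    using X unfolding Cauchy_iff by (meson entry le_less_trans)
  then have "\<exists>l. (\<lambda>n. Rep_m2 (X n) $ i $ j) \<longlonglongrightarrow> l" for i j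
    by (metis Cauchy_convergent convergent_def)
  then obtain l where l: "\<And>i j. (\<lambda>n. Rep_m2 (X n) $ i $ j) \<longlonglongrightarrow> l i j" by metis
  define L where "L = Abs_m2 (\<chi> i j. l i j)"
  have L: "Rep_m2 L $ i $ j = l i j" for i j by (simp add: L_def Abs_m2_inverse)
  let ?d = "\<lambda>i j n. norm (Rep_m2 (X n) $ i $ j - l i j)"
  have d: "?d i j \<longlonglongrightarrow> 0" for i j using l[of i j] by (simp add: LIM_zero tendsto_norm_zero)
  have "(\<lambda>n. ?d 1 1 n + ?d 1 2 n + ?d 2 1 n + ?d 2 2 n) \<longlonglongrightarrow> 0 + 0 + 0 + 0"
    by (intro tendsto_add d)
  moreover have "norm (X n - L) \<le> ?d 1 1 n + ?d 1 2 n + ?d 2 1 n + ?d 2 2 n" for n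
    using norm_m2_le_sum[of "X n - L"] by (simp add: minus_m2.rep_eq L)
  ultimately have "(\<lambda>n. X n - L) \<longlonglongrightarrow> 0"
    using Lim_null_comparison[OF always_eventually] by (metis (no_types, lifting) add_0)
  then show "convergent X" by (auto simp: convergent_def LIM_zero_iff)
qed

instantiation m2 :: (complex_banach_algebra_1) complex_banach_algebra_1
begin

lift_definition scaleC_m2 :: "complex \<Rightarrow> 'a m2 \<Rightarrow> 'a m2" is "\<lambda>z M. \<chi> i j. scaleC z (M $ i $ j)" .

instance
proof
  show "norm (scaleC z M) = cmod z * norm M" for z and M :: "'a m2"
    by transfer (simp add: m2_norm_def norm_scaleC max_mult_distrib_left flip: distrib_left)
  show "scaleC (of_real r) M = r *\<^sub>R M" for r and M :: "'a m2"
    by transfer (simp add: vec_eq_iff scaleC_of_real)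
qed (transfer; simp add: vec_eq_iff matrix_matrix_mult_def sum_2 scaleC_simps)+

end

lemma invertible_Rep_m2: "invertible (Rep_m2 M) \<longleftrightarrow> inv_el M"
  unfolding invertible_def inv_el_def
  by transfer simp

lemma spec_M2_Rep_m2: "spec_M2 (Rep_m2 M) = spec M"
proof -
  have "Rep_m2 (M - scaleC z 1) = Rep_m2 M - mat (scaleC z 1)" for z
    by transfer (simp add: vec_eq_iff mat_def)
  then show ?thesis
    unfolding spec_M2_def spec_def invertible_Rep_m2[symmetric] by simp
qed

lemma mpow_Rep_m2: "mpow (Rep_m2 M) n = Rep_m2 (M ^ n)"
  by (induction n) (simp_all add: mpow_def one_m2.rep_eq times_m2.rep_eq)

lemma gpi_Hirano_M2_Rep_m2: "gpi_Hirano_M2 (Rep_m2 M) \<longleftrightarrow> gpi_Hirano M"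
proof -
  have ex: "(\<exists>X. P X) \<longleftrightarrow> (\<exists>X. P (Rep_m2 X))" for P by (metis Abs_m2_inverse UNIV_I)
  show ?thesis
    unfolding gpi_Hirano_M2_def gpi_Hirano_def qnil_M2_def qnil_def mpow_Rep_m2
    by (subst ex) (simp add: spec_M2_Rep_m2 Rep_m2_inject flip: times_m2.rep_eq minus_m2.rep_eq)
qed

section \<open>The spectrum of the block matrix\<close>

text \<open>Says that \<open>x\<close> times every word of length \<open>m\<close> in the letters
  \<open>a\<close> and \<open>d\<close> is zero. Peeling off the first letter keeps word lists out
  of the inductions on \<open>m\<close>.\<close>

fun annihilates :: "'a::ring_1 \<Rightarrow> 'a \<Rightarrow> nat \<Rightarrow> 'a \<Rightarrow> bool" where
  "annihilates a d 0 x \<longleftrightarrow> x = 0"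
| "annihilates a d (Suc m) x \<longleftrightarrow> annihilates a d m (x * a) \<and> annihilates a d m (x * d)"

lemma annihilatesI:
  "(\<And>\<alpha>s. length \<alpha>s = m \<Longrightarrow> set \<alpha>s \<subseteq> {a, d} \<Longrightarrow> x * prod_list \<alpha>s = 0) \<Longrightarrow> annihilates a d m x"
proof (induction m arbitrary: x)
  case 0
  then show ?case using "0.prems"[of "[]"] by simp
next
  case (Suc m)
  have "x * a * prod_list \<alpha>s = 0" "x * d * prod_list \<alpha>s = 0"
    if "length \<alpha>s = m" "set \<alpha>s \<subseteq> {a, d}" for \<alpha>s
    using Suc.prems[of "a # \<alpha>s"] Suc.prems[of "d # \<alpha>s"] that by (simp_all add: mult.assoc)
  then show ?case using Suc.IH by simp
qed

lemma annihilates_zero: "annihilates a d m 0"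
  by (induction m) auto

lemma annihilates_Suc: "annihilates a d m x \<Longrightarrow> annihilates a d (Suc m) x"
  by (induction m arbitrary: x) auto

lemma annihilates_mono: "annihilates a d m x \<Longrightarrow> m \<le> n \<Longrightarrow> annihilates a d n x"
  by (induction n) (auto simp: le_Suc_eq annihilates_Suc simp del: annihilates.simps)

lemma annihilates_add: "annihilates a d m x \<Longrightarrow> annihilates a d m y \<Longrightarrow> annihilates a d m (x + y)"
  by (induction m arbitrary: x y) (auto simp: distrib_right)

lemma annihilates_sum: "(\<And>i. i \<in> I \<Longrightarrow> annihilates a d m (f i)) \<Longrightarrow> annihilates a d m (\<Sum>i\<in>I. f i)"
  by (induction I rule: infinite_finite_induct) (auto simp: annihilates_zero annihilates_add)

lemma annihilates_scaleC:
  "annihilates a d m x \<Longrightarrow> annihilates a d m (scaleC z (x :: 'a::complex_banach_algebra_1))"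
  by (induction m arbitrary: x) (auto simp: mult_scaleC_left)

lemma annihilates_mult_lincomb:
  "annihilates a d (Suc m) x \<Longrightarrow> annihilates a d m (x * (scaleC z a + (d :: 'a::complex_banach_algebra_1)))"
  by (simp add: distrib_left mult_scaleC_right annihilates_add annihilates_scaleC)

lemma annihilates_mult_lincomb_power:
  "annihilates a d m x \<Longrightarrow> annihilates a d (m - j) (x * (scaleC z a + (d :: 'a::complex_banach_algebra_1)) ^ j)"
proof (induction j)
  case (Suc j)
  define y where "y = x * (scaleC z a + d) ^ j"
  have *: "x * (scaleC z a + d) ^ Suc j = y * (scaleC z a + d)"
    by (simp add: y_def power_Suc2 mult.assoc del: power_Suc)
  have y: "annihilates a d (m - j) y" using Suc by (simp add: y_def)
  show ?case
  proof (cases "m - j")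
    \<comment> \<open>The subtraction is truncated: at level \<open>0\<close> the product has
      already vanished and stays zero.\<close>
    case 0
    with y show ?thesis unfolding * by simp
  next
    case (Suc i)
    with y have "annihilates a d i (y * (scaleC z a + d))" by (intro annihilates_mult_lincomb) simp
    with Suc show ?thesis unfolding * by (simp add: diff_Suc)
  qed
qed simp

lemma annihilates_mult_power:
  assumes "annihilates a d m x"
  shows "annihilates a d m (x * (scaleC z a + (d :: 'a::complex_banach_algebra_1)) ^ j)"
  by (rule annihilates_mono[OF annihilates_mult_lincomb_power[OF assms]]) simp

section \<open>Invertibility of the pencil and of the shifted block matrix\<close>

lemma inv_el_nilpotent_diff:
  fixes \<nu> :: "'a::complex_banach_algebra_1"
  assumes "\<nu> ^ m = 0" "z \<noteq> 0"
  shows "inv_el (\<nu> - scaleC z 1)"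
proof -
  define w where "w = scaleC (1 / z) \<nu>"
  have "w ^ m = 0" using assms(1) by (simp add: w_def scaleC_power)
  then have "norm (w ^ n) = 0" if "n \<ge> m" for n
    using that by (metis le_Suc_ex mult_zero_left norm_zero power_add)
  then have "summable (\<lambda>n. norm (w ^ n))"
    by (intro summable_finite[of "{..<m}"]) (auto simp: not_less)
  then have "inv_el (scaleC (- z) (1 - w))"
    using assms(2) by (subst inv_el_scaleC) (auto intro: inv_el_one_minus)
  then show ?thesis using assms(2) by (simp add: w_def scaleC_simps)
qed

text \<open>The point is the nilpotency of \<open>\<nu>\<close>. It is \<open>a * d\<close> times a
  polynomial in \<open>y\<close>, and multiplying by powers of \<open>y\<close> preserves the
  annihilation level. The letters \<open>a\<close> and \<open>d\<close> lower the level, so a power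
  of \<open>\<nu>\<close> vanishes and \<open>\<nu> - z\<close> can be cancelled.\<close>

lemma inv_el_pencil_iff:
  fixes a d :: "'a::complex_banach_algebra_1"
  assumes ann: "annihilates a d k (a * d)" and z: "z \<noteq> 0"
  shows "inv_el (scaleC z a + d - scaleC (z\<^sup>2) 1)
    \<longleftrightarrow> inv_el ((a - scaleC z 1) * (d - scaleC (z\<^sup>2) 1))"
proof -
  define y x T where "y = scaleC z a + d" and "x = scaleC (1 / z\<^sup>2) y"
    and "T = scaleC z a + d - scaleC (z\<^sup>2) 1"
  define s where "s = scaleC (- (1 / z\<^sup>2)) (\<Sum>j<k. x ^ j)"
  define \<nu> where "\<nu> = a * d * s"
  have T: "T = scaleC (- (z\<^sup>2)) (1 - x)"
    using z by (simp add: T_def x_def y_def scaleC_simps)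
  have sum: "(\<Sum>j<k. x ^ j) * (1 - x) = 1 - x ^ k"
    using one_minus_mult_sum_power[of x k]
    by (simp add: left_diff_distrib right_diff_distrib sum_distrib_left sum_distrib_right
        power_commutes sum_subtractf)
  have xs: "\<nu>' * x ^ j = scaleC ((1 / z\<^sup>2) ^ j) (\<nu>' * y ^ j)" for \<nu>' j
    by (simp add: x_def scaleC_power mult_scaleC_right)
  have "annihilates a d (k - k) (a * d * y ^ k)"
    unfolding y_def by (rule annihilates_mult_lincomb_power[OF ann])
  then have "a * d * x ^ k = 0" by (simp add: xs)
  moreover have "s * T = 1 - x ^ k"
    using z sum by (simp add: s_def T mult_scaleC_left mult_scaleC_right scaleC_scaleC scaleC_one)
  ultimately have "\<nu> * T = a * d" by (simp add: \<nu>_def mult.assoc right_diff_distrib)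
  then have fac: "(a - scaleC z 1) * (d - scaleC (z\<^sup>2) 1) = (\<nu> - scaleC z 1) * T"
    by (simp add: left_diff_distrib) (simp add: T_def scaleC_simps algebra_simps power2_eq_square)
  have mult_\<nu>: "annihilates a d m (w * \<nu>)" if "annihilates a d m (w * (a * d))" for m w
  proof -
    have "annihilates a d m (w * (a * d) * y ^ j)" for j
      unfolding y_def using that by (rule annihilates_mult_power)
    then have "annihilates a d m (w * (a * d) * s)"
      unfolding s_def mult_scaleC_right sum_distrib_left xs by (intro annihilates_scaleC annihilates_sum)
    then show ?thesis by (simp add: \<nu>_def mult.assoc)
  qed
  have nil: "w * \<nu> ^ m = 0" if "annihilates a d m w" for m w
    using that
  proof (induction m arbitrary: w)
    case (Suc m)
    \<comment> \<open>The letter \<open>a\<close> lowers the level to \<open>m\<close>, which is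
      weakened back to \<open>Suc m\<close> so that unfolding by the letter \<open>d\<close> ends at
      level \<open>m\<close>.\<close>
    have "annihilates a d (Suc m) (w * a)" using Suc.prems by (intro annihilates_Suc) simp
    then have "annihilates a d m (w * \<nu>)" by (intro mult_\<nu>) (simp add: mult.assoc)
    then show ?case using Suc.IH[of "w * \<nu>"] by (simp add: mult.assoc)
  qed simp
  have "annihilates a d k \<nu>" using mult_\<nu>[of k 1] ann by simp
  \<comment> \<open>The first factor \<open>\<nu>\<close> has level \<open>k\<close>, and each of
    the \<open>k\<close> further factors lowers it by one.\<close>
  then have "\<nu> ^ Suc k = 0" using nil by simp
  then have "inv_el (\<nu> - scaleC z 1)" using z by (rule inv_el_nilpotent_diff)
  then show ?thesis unfolding fac T_def[symmetric] by (simp only: inv_el_mult_left_cancel)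
qed

text \<open>The lower right entry \<open>- z\<close> is invertible, and the corresponding Schur
  complement is \<open>a - z + b * c / z\<close>, which is the right-hand pencil divided by
  \<open>z\<close>.\<close>

lemma inv_el_m2_iff:
  fixes a b c :: "'a::complex_banach_algebra_1"
  assumes z: "z \<noteq> 0"
  shows "inv_el (Abs_m2 (mat2 a b c 0) - scaleC z 1) \<longleftrightarrow> inv_el (scaleC z a + b * c - scaleC (z\<^sup>2) 1)"
    (is "inv_el ?M \<longleftrightarrow> inv_el ?T")
proof -
  have M: "Rep_m2 ?M = mat2 (a - scaleC z 1) b c (scaleC (- z) 1)"
    by (simp add: minus_m2.rep_eq scaleC_m2.rep_eq one_m2.rep_eq Abs_m2_inverse)
      (simp add: vec_eq_iff forall_2 mat2_def mat_def scaleC_simps)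
  have inv: "inv_el ?M \<longleftrightarrow> (\<exists>N. mat2 (a - scaleC z 1) b c (scaleC (- z) 1) ** N = mat 1
      \<and> N ** mat2 (a - scaleC z 1) b c (scaleC (- z) 1) = mat 1)"
    unfolding invertible_Rep_m2[symmetric] invertible_def M ..
  note entry = vec_eq_iff forall_2 matrix_matrix_mult_def mat_def mat2_def sum_2 scaleC_simps
  have T: "?T = scaleC z (a - scaleC z 1 + scaleC (1 / z) (b * c))"
    using z by (simp add: scaleC_simps power2_eq_square)
  show ?thesis
  proof
    assume "inv_el ?M"
    then obtain N :: "'a^2^2" where N: "(a - scaleC z 1) * N $ 1 $ 1 + b * N $ 2 $ 1 = 1"
      "c * N $ 1 $ 1 - scaleC z (N $ 2 $ 1) = 0"
      "N $ 1 $ 1 * (a - scaleC z 1) + N $ 1 $ 2 * c = 1"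
      "N $ 1 $ 1 * b - scaleC z (N $ 1 $ 2) = 0"
      unfolding inv by (auto simp: entry)
    \<comment> \<open>Eliminating the off-diagonal entries shows that the upper left entry of
      \<open>N\<close> inverts the Schur complement.\<close>
    have "N $ 2 $ 1 = scaleC (1 / z) (c * N $ 1 $ 1)" "N $ 1 $ 2 = scaleC (1 / z) (N $ 1 $ 1 * b)"
      using N(2,4) z by (simp_all add: scaleC_simps)
    then have "(a - scaleC z 1 + scaleC (1 / z) (b * c)) * N $ 1 $ 1 = 1"
      "N $ 1 $ 1 * (a - scaleC z 1 + scaleC (1 / z) (b * c)) = 1"
      using N(1,3)
      by (simp_all add: distrib_left distrib_right mult_scaleC_left mult_scaleC_right mult.assoc)
    then show "inv_el ?T" unfolding T using z by (subst inv_el_scaleC) (auto intro: inv_elI)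
  next
    assume "inv_el ?T"
    then have "inv_el (a - scaleC z 1 + scaleC (1 / z) (b * c))"
      unfolding T using z by (subst (asm) inv_el_scaleC) auto
    then obtain p where p: "(a - scaleC z 1 + scaleC (1 / z) (b * c)) * p = 1"
      "p * (a - scaleC z 1 + scaleC (1 / z) (b * c)) = 1" by (auto simp: inv_el_def)
    \<comment> \<open>The block inverse formula, with \<open>p\<close> the inverse of the Schur
      complement.\<close>
    define N where "N = mat2 p (scaleC (1 / z) (p * b)) (scaleC (1 / z) (c * p))
      (scaleC (- (1 / z)) 1 + scaleC (1 / z\<^sup>2) (c * p * b))"
    have 1: "a * p - scaleC z p + scaleC (1 / z) (b * c * p) = 1"
      "p * a - scaleC z p + scaleC (1 / z) (p * b * c) = 1"
      using p by (simp_all add: algebra_simps scaleC_simps)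
    have 2: "a * p * b - scaleC z (p * b) + scaleC (1 / z) (b * c * p * b) = b"
      "c * p * a - scaleC z (c * p) + scaleC (1 / z) (c * p * b * c) = c"
      using arg_cong[OF 1(1), of "\<lambda>x. x * b"] arg_cong[OF 1(2), of "\<lambda>x. c * x"]
      by (simp_all add: algebra_simps scaleC_simps)
    have 3: "scaleC (1 / z) (a * p * b) - p * b + scaleC (1 / z\<^sup>2) (b * c * p * b) = scaleC (1 / z) b"
      "scaleC (1 / z) (c * p * a) - c * p + scaleC (1 / z\<^sup>2) (c * p * b * c) = scaleC (1 / z) c"
      using arg_cong[OF 2(1), of "scaleC (1 / z)"] arg_cong[OF 2(2), of "scaleC (1 / z)"] z
      by (simp_all add: scaleC_simps power2_eq_square)
    show "inv_el ?M" unfolding inv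
    proof (intro exI conjI)
      show "mat2 (a - scaleC z 1) b c (scaleC (- z) 1) ** N = mat 1"
        using 1(1) 3(1) z by (simp add: N_def entry power2_eq_square algebra_simps)
      show "N ** mat2 (a - scaleC z 1) b c (scaleC (- z) 1) = mat 1"
        using 1(2) 3(2) z by (simp add: N_def entry power2_eq_square algebra_simps)
    qed
  qed
qed

theorem theorem4p6:
  fixes a b c :: "'a::complex_banach_algebra_1" and k :: nat
  assumes "k > 0"
    and "\<forall>\<alpha>s. length \<alpha>s = k \<and> set \<alpha>s \<subseteq> {a, b * c} \<longrightarrow> a * (b * c) * prod_list \<alpha>s = 0"
  shows "(gpi_Hirano a \<and> gpi_Hirano (b * c)) \<longleftrightarrow> gpi_Hirano_M2 (mat2 a b c 0)"
proof -
  define d M where "d = b * c" and "M = Abs_m2 (mat2 a b c 0)"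
  have "annihilates a d k (a * d)" by (rule annihilatesI) (use assms(2) in \<open>auto simp: d_def\<close>)
  then have M_iff: "inv_el (M - scaleC z 1) \<longleftrightarrow> inv_el ((a - scaleC z 1) * (d - scaleC (z\<^sup>2) 1))"
    if "z \<noteq> 0" for z
    unfolding M_def inv_el_m2_iff[OF that] d_def[symmetric] using that by (rule inv_el_pencil_iff)
  have "gpi_Hirano M" if a: "gpi_Hirano a" and d: "gpi_Hirano d"
  proof -
    obtain n where n: "n > 0" "\<And>z. z \<noteq> 0 \<Longrightarrow> z ^ n \<noteq> 1 \<Longrightarrow> inv_el (a - scaleC z 1)"
      using gpi_Hirano_imp_inv_el[OF a] by metis
    obtain m where m: "m > 0" "\<And>z. z \<noteq> 0 \<Longrightarrow> z ^ m \<noteq> 1 \<Longrightarrow> inv_el (d - scaleC z 1)"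
      using gpi_Hirano_imp_inv_el[OF d] by metis
    show ?thesis
    proof (rule inv_el_imp_gpi_Hirano)
      \<comment> \<open>A common multiple of \<open>n\<close> and \<open>2 * m\<close>: the factor
        \<open>2\<close> is there because \<open>d\<close> is shifted by
        \<open>z ^ 2\<close>.\<close>
      show "2 * m * n > 0" using n m by simp
      fix z :: complex assume z: "z \<noteq> 0" "z ^ (2 * m * n) \<noteq> 1"
      have "z ^ n \<noteq> 1" using z(2) by (metis mult.commute power_mult power_one)
      moreover have "(z\<^sup>2) ^ m \<noteq> 1" using z(2) by (metis power_mult power_one)
      ultimately show "inv_el (M - scaleC z 1)"
        unfolding M_iff[OF z(1)] using z n m by (intro inv_el_mult) auto
    qed
  qed
  moreover have "gpi_Hirano a \<and> gpi_Hirano d" if M: "gpi_Hirano M"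
  proof -
    obtain n where n: "n > 0" "\<And>z. z \<noteq> 0 \<Longrightarrow> z ^ n \<noteq> 1 \<Longrightarrow> inv_el (M - scaleC z 1)"
      using gpi_Hirano_imp_inv_el[OF M] by metis
    \<comment> \<open>Removing finitely many points leaves the plane connected.\<close>
    define S where "S = UNIV - insert 0 {z :: complex. z ^ n = 1}"
    have "connected S" unfolding S_def
      by (intro connected_open_delete_finite) (use n finite_roots_unity[of n] in auto)
    \<comment> \<open>The modulus exceeds \<open>norm a\<close>, so \<open>a - z0\<close> is
      invertible, and exceeds \<open>1\<close>, so \<open>z0\<close> is no root of unity.\<close>
    define z0 :: complex where "z0 = of_real (norm a + 2)"
    have cz0: "cmod z0 = norm a + 2" unfolding z0_def norm_of_real by simp
    have "cmod (z0 ^ n) > 1"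
      unfolding norm_power cz0 by (rule one_less_power) (use n in \<open>auto simp: add_pos_nonneg\<close>)
    moreover have "cmod z0 > 0" unfolding cz0 by (rule add_nonneg_pos) auto
    ultimately have z0: "z0 \<in> S" "inv_el (a - scaleC z0 1)"
      using cz0 by (auto simp: S_def intro: inv_el_diff_scaleC_large)
    have inv: "inv_el (a - scaleC z 1)" "inv_el (d - scaleC (z\<^sup>2) 1)" if "z \<noteq> 0" "z ^ n \<noteq> 1" for z
    proof -
      have fg: "inv_el ((a - scaleC z 1) * (d - scaleC (z\<^sup>2) 1))" if "z \<in> S" for z
        using that n M_iff by (auto simp: S_def)
      have z: "z \<in> S" using that by (simp add: S_def)
      have "continuous_on S (\<lambda>z. a - scaleC z 1)" "continuous_on S (\<lambda>z. d - scaleC (z\<^sup>2) 1)"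
        by (intro continuous_intros)+
      from inv_el_factors_connected[OF \<open>connected S\<close> this fg z0 z]
      show "inv_el (a - scaleC z 1)" "inv_el (d - scaleC (z\<^sup>2) 1)" by simp_all
    qed
    have "inv_el (d - scaleC w 1)" if "w \<noteq> 0" "w ^ n \<noteq> 1" for w
    proof -
      \<comment> \<open>Every shift \<open>w\<close> of \<open>d\<close> is a square, and
        \<open>w ^ n \<noteq> 1\<close> forces the same for its root, so the exponent
        \<open>n\<close> also serves for \<open>d\<close>.\<close>
      have sq: "(csqrt w)\<^sup>2 = w" by simp
      have "csqrt w ^ n \<noteq> 1" using that(2) sq by (metis mult.commute power_mult power_one)
      then show ?thesis using inv(2)[of "csqrt w"] that by simp
    qed
    then show ?thesis using inv n by (blast intro: inv_el_imp_gpi_Hirano)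
  qed
  ultimately show ?thesis
    using gpi_Hirano_M2_Rep_m2[of M] by (auto simp: M_def d_def Abs_m2_inverse)
qed

end
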